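(* Let $G$ be a finite simple graph and let $\theta:\mathbb{Z}_2\to \mathrm{Aut}(G)$ be an action of the group $\mathbb{Z}_2=\langle s\rangle$. If $G$ is expressible as a union of two edge-disjoint spanning trees, both of which are $\mathbb{Z}_2$-symmetric with respect to $\theta$, and no edge of $G$ is fixed by $s$, then there exists a construction chain $$W_5=G^1\to G^2\to\cdots\to G^n=G$$ such that for each $k=1,2,\ldots,n-1$, (i) $G^k\to G^{k+1}$ is an allowable $(\mathbb{Z}_2,\theta)$ graph extension, and (ii) $G^k$ is expressible as a union of two edge-disjoint spanning trees, both of which are $\mathbb{Z}_2$-symmetric with respect to $\theta$, and no edge of $G^k$ is fixed by $s$.
   Context: An action of $\mathbb{Z}_2=\langle s\rangle$ on a simple graph $G$ is a homomorphism $\theta:\mathbb{Z}_2\to\mathrm{Aut}(G)$ ($\mathrm{Aut}(G)$: permutations of $V(G)$ preserving adjacency and non-adjacency). Write $sv=\theta(s)v$, $s(vw)=(sv)(sw)$. A vertex $v$ is fixed by $s$ if $sv=v$; an edge $vw$ is fixed by $s$ if $s(vw)=vw$ as an unordered pair. A graph $H$ with $V(H)\subseteq V(G)$ is $\mathbb{Z}_2$-symmetric with respect to $\theta$ if $V(H)$ is invariant under $\theta(s)$ and the restriction of $\theta(s)$ to $V(H)$ is an automorphism of $H$; the induced action is again denoted $\theta$. The wheel graph $W_5$ has five distinct vertices $v_0,\dots,v_4$ and edges $v_1v_2,v_2v_3,v_3v_4,v_4v_1$ and $v_0v_j$ ($1\le j\le4$). The action $\theta^*$ of $\mathbb{Z}_2$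 on $W_5$ is $sv_0=v_0$, $sv_1=v_3$, $sv_2=v_4$. In the chain, "$W_5=G^1$" means $G^1$ is a copy of $W_5$. Let $G$ be a simple graph which is $\mathbb{Z}_2$-symmetric with respect to $\theta$, and let $H$ be a graph which is $\mathbb{Z}_2$-symmetric with respect to $\theta$. - $G$ is obtained from $H$ by a $(\mathbb{Z}_2,\theta)$ $0$-extension if $V(G)=V(H)\cup\{v,sv\}$ with $v,sv\notin V(H)$, $v\neq sv$, and there are distinct $v_1,v_2\in V(H)$ with $E(G)=E(H)\cup\{vv_1,vv_2,s(vv_1),s(vv_2)\}$. - $G$ is obtained from $H$ by a $(\mathbb{Z}_2,\theta)$ $1$-extension if $V(G)=V(H)\cup\{v,sv\}$ with $v,sv\notin V(H)$, $v\ne sv$, and there are distinct $v_1,v_2,v_3\in V(H)$ and an edge $e=v_1v_2\in E(H)$ with $e\ne se$ and $E(G)=(E(H)\setminus\{e,se\})\cup\{vv_i,s(vv_i): i=1,2,3\}$. - $G$ is obtained from $H$ by a modified $(\mathbb{Z}_2,\theta)$ $1$-extension if $V(G)=V(H)\cup\{v,sv\}$ with $v,sv\notin V(H)$, $v\ne sv$, and there are distinct $v_1,v_2,v_3\in V(H)$ and an edge $e=v_1(sv_2)\in E(H)$ such that $v_1,v_2,sv_1,sv_2$ are distinct and $E(G)=(E(H)\setminus\{e,se\})\cup\{vv_i,s(vv_i): i=1,2,3\}$. - $G$ is obtained from $H$ by a $(\mathbb{Z}_2,\theta)$ fixed-vertex-to-$W_5$ extension if $W_5$ is a subgraph of $G$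 on which $\theta$ restricts to $\theta^*$, $V(G)=V(H)\cup V(W_5)$, $V(H)\cap V(W_5)=\{v_0\}$ where $v_0$ is the $4$-valent vertex of $W_5$, and $E(G)=E(W_5)\cup(E(H)\setminus\{wv_0\in E(H): w\in N(v_0)\})\cup\{w\pi(w): w\in N(v_0)\}$, where $N(v_0)$ is the set of neighbours of $v_0$ in $H$ and $\pi:N(v_0)\to V(W_5)$ is some map with $s(\pi(w))=\pi(sw)$ for all $w\in N(v_0)$. These four graph extensions are called allowable; $H\to G$ means that $G$ is obtained from $H$ by an allowable $(\mathbb{Z}_2,\theta)$ graph extension. *)

theory Defs
  imports "HOL-Algebra.Bij" "HOL-Algebra.Elementary_Groups"
begin

section \<open>Simple graphs and trees\<close>

record 'v ugraph =
  verts :: "'v set"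
  edges :: "'v set set"

definition simple_graph :: "'v ugraph \<Rightarrow> bool" where
  "simple_graph G \<longleftrightarrow> (\<forall>e\<in>edges G. e \<subseteq> verts G \<and> card e = 2)"

definition subgraph_of :: "'v ugraph \<Rightarrow> 'v ugraph \<Rightarrow> bool" where
  "subgraph_of H G \<longleftrightarrow> verts H \<subseteq> verts G \<and> edges H \<subseteq> edges G"

definition neighbours :: "'v ugraph \<Rightarrow> 'v \<Rightarrow> 'v set" where
  "neighbours G v = {w \<in> verts G. {w, v} \<in> edges G}"

definition connected_graph :: "'v ugraph \<Rightarrow> bool" where
  "connected_graph G \<longleftrightarrow> verts G \<noteq> {} \<and>
     (\<forall>u\<in>verts G. \<forall>v\<in>verts G. (u, v) \<in> {(x, y). {x, y} \<in> edges G}\<^sup>*)"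

text \<open>A cycle is given by the cyclic list of its vertices.\<close>

definition is_cycle :: "'v ugraph \<Rightarrow> 'v list \<Rightarrow> bool" where
  "is_cycle G c \<longleftrightarrow> length c \<ge> 3 \<and> distinct c \<and>
     (\<forall>i<length c. {c ! i, c ! (Suc i mod length c)} \<in> edges G)"

definition is_tree :: "'v ugraph \<Rightarrow> bool" where
  "is_tree T \<longleftrightarrow> simple_graph T \<and> connected_graph T \<and> (\<nexists>c. is_cycle T c)"

definition spanning_tree :: "'v ugraph \<Rightarrow> 'v ugraph \<Rightarrow> bool" where
  "spanning_tree T G \<longleftrightarrow> is_tree T \<and> subgraph_of T G \<and> verts T = verts G"


section \<open>Actions of the group of order two\<close>

definition graph_auts :: "'v ugraph \<Rightarrow> ('v \<Rightarrow> 'v) set" where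
  "graph_auts G = {f \<in> Bij (verts G).
     \<forall>v\<in>verts G. \<forall>w\<in>verts G. {f v, f w} \<in> edges G \<longleftrightarrow> {v, w} \<in> edges G}"

definition aut_group :: "'v ugraph \<Rightarrow> ('v \<Rightarrow> 'v) monoid" where
  "aut_group G = (BijGroup (verts G))\<lparr>carrier := graph_auts G\<rparr>"

text \<open>
  The group of order two is \<^term>\<open>integer_mod_group 2\<close>, whose generator is the integer 1.
  In the definitions below, the argument \<open>s\<close> is the permutation of the vertices by which
  this generator acts, that is, the value at 1 of the homomorphism; it acts on an edge
  (a set of two vertices) by taking images.
\<close>

definition z2_action :: "(int \<Rightarrow> 'v \<Rightarrow> 'v) \<Rightarrow> 'v ugraph \<Rightarrow> bool" where
  "z2_action \<theta> G \<longleftrightarrow> \<theta> \<in> hom (integer_mod_group 2) (aut_group G)"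

definition z2_symmetric :: "('v \<Rightarrow> 'v) \<Rightarrow> 'v ugraph \<Rightarrow> bool" where
  "z2_symmetric s H \<longleftrightarrow> s ` verts H \<subseteq> verts H \<and> restrict s (verts H) \<in> graph_auts H"

definition no_fixed_edge :: "('v \<Rightarrow> 'v) \<Rightarrow> 'v ugraph \<Rightarrow> bool" where
  "no_fixed_edge s G \<longleftrightarrow> (\<forall>e\<in>edges G. s ` e \<noteq> e)"

text \<open>
  The two trees are required to be distinct.  As soon as there is an edge this follows from
  edge-disjointness; it only matters for the graph with a single vertex, which has only one
  spanning tree and is therefore not a union of two of them.
\<close>

definition two_symmetric_spanning_trees :: "('v \<Rightarrow> 'v) \<Rightarrow> 'v ugraph \<Rightarrow> bool" where
  "two_symmetric_spanning_trees s G \<longleftrightarrow>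
     (\<exists>T\<^sub>1 T\<^sub>2. T\<^sub>1 \<noteq> T\<^sub>2 \<and>
        spanning_tree T\<^sub>1 G \<and> spanning_tree T\<^sub>2 G \<and>
        edges T\<^sub>1 \<inter> edges T\<^sub>2 = {} \<and> edges G = edges T\<^sub>1 \<union> edges T\<^sub>2 \<and>
        z2_symmetric s T\<^sub>1 \<and> z2_symmetric s T\<^sub>2)"


section \<open>The wheel\<close>

text \<open>The hub is \<open>v0\<close>; the five vertices are meant to be distinct.\<close>

definition wheel5 :: "'v \<Rightarrow> 'v \<Rightarrow> 'v \<Rightarrow> 'v \<Rightarrow> 'v \<Rightarrow> 'v ugraph" where
  "wheel5 v0 v1 v2 v3 v4 =
     \<lparr> verts = {v0, v1, v2, v3, v4},
       edges = {{v1, v2}, {v2, v3}, {v3, v4}, {v4, v1},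
                {v0, v1}, {v0, v2}, {v0, v3}, {v0, v4}} \<rparr>"

definition is_wheel5 :: "'v ugraph \<Rightarrow> bool" where
  "is_wheel5 W \<longleftrightarrow>
     (\<exists>v0 v1 v2 v3 v4. distinct [v0, v1, v2, v3, v4] \<and> W = wheel5 v0 v1 v2 v3 v4)"

text \<open>The half-turn of the wheel.\<close>

definition acts_as_theta_star :: "('v \<Rightarrow> 'v) \<Rightarrow> 'v \<Rightarrow> 'v \<Rightarrow> 'v \<Rightarrow> 'v \<Rightarrow> 'v \<Rightarrow> bool" where
  "acts_as_theta_star s v0 v1 v2 v3 v4 \<longleftrightarrow>
     s v0 = v0 \<and> s v1 = v3 \<and> s v3 = v1 \<and> s v2 = v4 \<and> s v4 = v2"


section \<open>Allowable extensions\<close>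

text \<open>In each case the second graph is obtained from the first one.\<close>

definition symmetric_pair :: "('v \<Rightarrow> 'v) \<Rightarrow> 'v ugraph \<Rightarrow> 'v ugraph \<Rightarrow> bool" where
  "symmetric_pair s H G \<longleftrightarrow>
     simple_graph H \<and> z2_symmetric s H \<and> simple_graph G \<and> z2_symmetric s G"

definition adds_vertex_orbit :: "('v \<Rightarrow> 'v) \<Rightarrow> 'v ugraph \<Rightarrow> 'v ugraph \<Rightarrow> 'v \<Rightarrow> bool" where
  "adds_vertex_orbit s H G v \<longleftrightarrow>
     verts G = verts H \<union> {v, s v} \<and> v \<notin> verts H \<and> s v \<notin> verts H \<and> v \<noteq> s v"

definition zero_extension :: "('v \<Rightarrow> 'v) \<Rightarrow> 'v ugraph \<Rightarrow> 'v ugraph \<Rightarrow> bool" where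
  "zero_extension s H G \<longleftrightarrow> symmetric_pair s H G \<and>
     (\<exists>v v1 v2. adds_vertex_orbit s H G v \<and>
        {v1, v2} \<subseteq> verts H \<and> v1 \<noteq> v2 \<and>
        edges G = edges H \<union> {{v, v1}, {v, v2}, s ` {v, v1}, s ` {v, v2}})"

definition one_extension :: "('v \<Rightarrow> 'v) \<Rightarrow> 'v ugraph \<Rightarrow> 'v ugraph \<Rightarrow> bool" where
  "one_extension s H G \<longleftrightarrow> symmetric_pair s H G \<and>
     (\<exists>v v1 v2 v3 e. adds_vertex_orbit s H G v \<and>
        {v1, v2, v3} \<subseteq> verts H \<and> distinct [v1, v2, v3] \<and>
        e = {v1, v2} \<and> e \<in> edges H \<and> e \<noteq> s ` e \<and>
        edges G = (edges H - {e, s ` e}) \<union>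
          {{v, v1}, {v, v2}, {v, v3}, s ` {v, v1}, s ` {v, v2}, s ` {v, v3}})"

definition modified_one_extension :: "('v \<Rightarrow> 'v) \<Rightarrow> 'v ugraph \<Rightarrow> 'v ugraph \<Rightarrow> bool" where
  "modified_one_extension s H G \<longleftrightarrow> symmetric_pair s H G \<and>
     (\<exists>v v1 v2 v3 e. adds_vertex_orbit s H G v \<and>
        {v1, v2, v3} \<subseteq> verts H \<and> distinct [v1, v2, v3] \<and>
        e = {v1, s v2} \<and> e \<in> edges H \<and> distinct [v1, v2, s v1, s v2] \<and>
        edges G = (edges H - {e, s ` e}) \<union>
          {{v, v1}, {v, v2}, {v, v3}, s ` {v, v1}, s ` {v, v2}, s ` {v, v3}})"

definition fixed_vertex_to_W5_extension :: "('v \<Rightarrow> 'v) \<Rightarrow> 'v ugraph \<Rightarrow> 'v ugraph \<Rightarrow> bool" where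
  "fixed_vertex_to_W5_extension s H G \<longleftrightarrow> symmetric_pair s H G \<and>
     (\<exists>v0 v1 v2 v3 v4 W \<pi>. distinct [v0, v1, v2, v3, v4] \<and> W = wheel5 v0 v1 v2 v3 v4 \<and>
        subgraph_of W G \<and> acts_as_theta_star s v0 v1 v2 v3 v4 \<and>
        verts G = verts H \<union> verts W \<and> verts H \<inter> verts W = {v0} \<and>
        \<pi> \<in> neighbours H v0 \<rightarrow> verts W \<and>
        (\<forall>w\<in>neighbours H v0. s (\<pi> w) = \<pi> (s w)) \<and>
        edges G = edges W \<union> (edges H - {{w, v0} |w. {w, v0} \<in> edges H}) \<union>
          {{w, \<pi> w} |w. w \<in> neighbours H v0})"

definition allowable_extension :: "('v \<Rightarrow> 'v) \<Rightarrow> 'v ugraph \<Rightarrow> 'v ugraph \<Rightarrow> bool" where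
  "allowable_extension s H G \<longleftrightarrow>
     zero_extension s H G \<or> one_extension s H G \<or>
     modified_one_extension s H G \<or> fixed_vertex_to_W5_extension s H G"

end

theory Submission
  imports Defs
begin

text \<open>
  Write \<open>s\<close> for the action of the generator and \<open>V\<close> for the vertex set. A symmetric spanning tree
  has an even number of edges, since \<open>s\<close> fixes none of them; so \<open>card V\<close> is odd and \<open>s\<close> fixes
  some vertex \<open>r\<close>. Counting edges outwards from \<open>r\<close>, where edges arrive in pairs, shows that \<open>r\<close> is the
  only fixed vertex. All other vertices form orbits \<open>{v, s v}\<close>, and the argument takes place in the
  quotient by \<open>s\<close>, in which both trees become trees again.

  It suffices to show that \<open>G\<close> is a wheel or arises by an allowable extension from a smaller graph
  of the same kind (\<open>is_wheel5_or_reducible\<close>). The sum of the degrees is \<open>4 (card V - 1)\<close>, so some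
  vertex \<open>v\<close> other than \<open>r\<close> has degree at most three, and it meets both trees.

  If \<open>v\<close> has degree two, it is a leaf of both trees, and deleting its orbit undoes a 0-extension.

  If \<open>v\<close> has degree three, it is a leaf at \<open>a\<close> of one tree and the middle of a path \<open>b, v, c\<close> of
  the other. Deleting the orbit of \<open>v\<close> breaks the second tree, and an orbit of new edges between
  two of the neighbours must mend it. Between two orbits not containing \<open>r\<close> there is room for two
  edge orbits, those of \<open>{x, y}\<close> and \<open>{x, s y}\<close>, and a tree contains at most one of them
  (\<open>no_parallel\<close>); between \<open>r\<close> and another orbit there is room for one only. This is the only way in
  which the edge from \<open>b\<close> to \<open>c\<close> can be blocked, and then another edge between neighbours works,
  after exchanging an edge between the trees if need be (\<open>reducible_if_root_neighbour\<close>). The single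
  exception is that the neighbours are \<open>d\<close>, \<open>s d\<close> and \<open>r\<close>, with \<open>d\<close> adjacent to \<open>r\<close>.

  Suppose that all vertices of degree at most three, except possibly \<open>r\<close>, are of this exceptional
  type. They are neighbours of \<open>r\<close>, and by the sum of the degrees there are at least as many of them
  as \<open>r\<close> has neighbours. Hence every neighbour of \<open>r\<close>, in particular \<open>d\<close>, is of this type. Then
  \<open>r, v, d, s v, s d\<close> span a wheel which meets the rest of the graph in \<open>r\<close> only: either it is all
  of \<open>G\<close>, or shrinking it to \<open>r\<close> undoes a fixed-vertex-to-\<open>W\<^sub>5\<close> extension.

  Cycles never have to be followed along these operations, since a connected graph is a tree exactly
  if it has one edge less than vertices. Connectedness is tested on sets of vertices closed under
  adjacency, and for a symmetric set of edges on those that are also invariant under \<open>s\<close>.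
\<close>

section \<open>Trees and edge counts\<close>

definition closed_under :: "'v set set \<Rightarrow> 'v set \<Rightarrow> bool" where
  "closed_under E S \<longleftrightarrow> (\<forall>x\<in>S. \<forall>y. {x, y} \<in> E \<longrightarrow> y \<in> S)"

definition connects :: "'v set set \<Rightarrow> 'v \<Rightarrow> 'v set \<Rightarrow> bool" where
  "connects E r V \<longleftrightarrow> (\<forall>S\<subseteq>V. r \<in> S \<longrightarrow> closed_under E S \<longrightarrow> S = V)"

lemma closed_underD: "closed_under E S \<Longrightarrow> {x, y} \<in> E \<Longrightarrow> x \<in> S \<Longrightarrow> y \<in> S"
  unfolding closed_under_def by blast

lemma closed_under_iff: "closed_under E S \<Longrightarrow> {x, y} \<in> E \<Longrightarrow> x \<in> S \<longleftrightarrow> y \<in> S"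
  unfolding closed_under_def by (metis insert_commute)

lemma connected_graph_iff_connects:
  assumes "simple_graph G" "r \<in> verts G"
  shows "connected_graph G \<longleftrightarrow> connects (edges G) r (verts G)"
proof -
  define R where "R = {(x, y). {x, y} \<in> edges G}"
  have "sym R" by (auto simp: R_def sym_def insert_commute)
  then have sym: "(x, y) \<in> R\<^sup>* \<Longrightarrow> (y, x) \<in> R\<^sup>*" for x y
    by (metis sym_rtrancl symD)
  show ?thesis
  proof
    assume conn: "connected_graph G"
    show "connects (edges G) r (verts G)"
      unfolding connects_def
    proof (intro allI impI)
      fix S assume S: "S \<subseteq> verts G" "r \<in> S" "closed_under (edges G) S"
      have "y \<in> S" if "(r, y) \<in> R\<^sup>*" for y
        using that
      proof induction
        case base
        show ?case by (fact S(2))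
      next
        case (step y z)
        then show ?case using S(3) by (auto simp: R_def dest: closed_underD)
      qed
      then have "verts G \<subseteq> S"
        using conn assms(2) unfolding connected_graph_def R_def by auto
      then show "S = verts G" using S(1) by blast
    qed
  next
    assume conn: "connects (edges G) r (verts G)"
    define S where "S = {x \<in> verts G. (r, x) \<in> R\<^sup>*}"
    have "closed_under (edges G) S"
      unfolding closed_under_def
    proof (intro ballI allI impI)
      fix x y assume "x \<in> S" "{x, y} \<in> edges G"
      moreover from this have "y \<in> verts G"
        using assms(1) unfolding simple_graph_def by blast
      moreover have "(x, y) \<in> R" using calculation by (simp add: R_def)
      ultimately show "y \<in> S" unfolding S_def by (auto intro: rtrancl_into_rtrancl)
    qed
    moreover have "S \<subseteq> verts G" "r \<in> S" using assms(2) unfolding S_def by auto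
    ultimately have "S = verts G" using conn unfolding connects_def by blast
    then have reach: "(r, x) \<in> R\<^sup>*" if "x \<in> verts G" for x
      using that unfolding S_def by blast
    show "connected_graph G"
      unfolding connected_graph_def R_def[symmetric]
    proof (intro conjI ballI)
      show "verts G \<noteq> {}" using assms(2) by blast
    next
      fix u w assume "u \<in> verts G" "w \<in> verts G"
      then show "(u, w) \<in> R\<^sup>*" using reach sym by (meson rtrancl_trans)
    qed
  qed
qed

text \<open>
  Induction along a connected graph: a property of sets of vertices passes from \<open>{r}\<close> to \<open>V\<close> if every
  proper subset having it can be enlarged across any edge that leaves it. All edge counts below are
  instances.
\<close>

lemma connects_grow:
  assumes "finite V" "r \<in> V" "connects E r V" "\<forall>e\<in>E. e \<subseteq> V" "P {r}"
    and step: "\<And>S x y. \<lbrakk>S \<subseteq> V; r \<in> S; P S; x \<in> S; y \<in> V - S; {x, y} \<in> E\<rbrakk>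
                 \<Longrightarrow> \<exists>S'. S \<subset> S' \<and> S' \<subseteq> V \<and> P S'"
  shows "P V"
proof -
  have fin: "finite {S. S \<subseteq> V \<and> r \<in> S \<and> P S}" using assms(1) by simp
  have ne: "{S. S \<subseteq> V \<and> r \<in> S \<and> P S} \<noteq> {}"
    using assms(2,5) by (auto intro: exI[of _ "{r}"])
  from finite_has_maximal[OF fin ne] obtain M where "M \<in> {S. S \<subseteq> V \<and> r \<in> S \<and> P S}"
    and "\<forall>S\<in>{S. S \<subseteq> V \<and> r \<in> S \<and> P S}. M \<subseteq> S \<longrightarrow> M = S"
    by (rule bexE)
  then have M: "M \<subseteq> V" "r \<in> M" "P M"
    and max: "\<And>S. \<lbrakk>S \<subseteq> V; r \<in> S; P S; M \<subseteq> S\<rbrakk> \<Longrightarrow> S = M"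
    by auto
  have "closed_under E M"
  proof (rule ccontr)
    assume "\<not> closed_under E M"
    then obtain x y where xy: "x \<in> M" "{x, y} \<in> E" "y \<notin> M"
      unfolding closed_under_def by blast
    moreover have "y \<in> V" using xy assms(4) by blast
    ultimately obtain S' where "M \<subset> S'" "S' \<subseteq> V" "P S'"
      using step[of M x y] M by blast
    then show False using max[of S'] M by blast
  qed
  then have "M = V" using assms(3) M unfolding connects_def by blast
  then show ?thesis using M by simp
qed

lemma card_le_card_edges:
  assumes "finite V" "finite E" "r \<in> V" "connects E r V" "\<forall>e\<in>E. e \<subseteq> V"
  shows "card V \<le> card E + 1"
proof -
  have "card V \<le> card {e \<in> E. e \<subseteq> V} + 1"
  proof (rule connects_grow[OF assms(1,3,4,5)])
    show "card {r} \<le> card {e \<in> E. e \<subseteq> {r}} + 1" by simp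
  next
    fix S x y
    assume S: "S \<subseteq> V" "card S \<le> card {e \<in> E. e \<subseteq> S} + 1" "x \<in> S" "y \<in> V - S" "{x, y} \<in> E"
    have "finite S" using S(1) assms(1) by (rule finite_subset)
    have "insert {x, y} {e \<in> E. e \<subseteq> S} \<subseteq> {e \<in> E. e \<subseteq> insert y S}" using S by auto
    then have "card (insert {x, y} {e \<in> E. e \<subseteq> S}) \<le> card {e \<in> E. e \<subseteq> insert y S}"
      using assms(2) by (intro card_mono) auto
    moreover have "card (insert {x, y} {e \<in> E. e \<subseteq> S}) = Suc (card {e \<in> E. e \<subseteq> S})"
      using S assms(2) by (subst card_insert_disjoint) auto
    moreover have "card (insert y S) = Suc (card S)"
      using S \<open>finite S\<close> by simp
    ultimately have "card (insert y S) \<le> card {e \<in> E. e \<subseteq> insert y S} + 1"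
      using S(2) by linarith
    then show "\<exists>S'. S \<subset> S' \<and> S' \<subseteq> V \<and> card S' \<le> card {e \<in> E. e \<subseteq> S'} + 1"
      using S by (intro exI[of _ "insert y S"]) auto
  qed
  moreover have "{e \<in> E. e \<subseteq> V} = E" using assms(5) by blast
  ultimately show ?thesis by simp
qed

text \<open>
  A walk that returns to its first vertex can be cut short there.
\<close>

lemma simple_path_exists:
  assumes "(u, w) \<in> {(x, y). {x, y} \<in> F}\<^sup>*" "u \<in> S" "\<forall>e\<in>F. e \<subseteq> S"
  shows "\<exists>p. p \<noteq> [] \<and> hd p = u \<and> last p = w \<and> distinct p \<and> set p \<subseteq> S \<and>
             successively (\<lambda>x y. {x, y} \<in> F) p"
  using assms(1,2)
proof (induction rule: converse_rtrancl_induct)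
  case base
  then show ?case by (intro exI[of _ "[w]"]) auto
next
  case (step u z)
  then have "z \<in> S" using assms(3) by blast
  then obtain p where p: "p \<noteq> []" "hd p = z" "last p = w" "distinct p" "set p \<subseteq> S"
    "successively (\<lambda>x y. {x, y} \<in> F) p"
    using step by blast
  show ?case
  proof (cases "u \<in> set p")
    case True
    then obtain ys zs where "p = ys @ u # zs" by (meson split_list)
    then show ?thesis using p
      by (intro exI[of _ "u # zs"]) (auto simp: successively_append_iff)
  next
    case False
    then show ?thesis using p step
      by (intro exI[of _ "u # p"]) (auto simp: successively_Cons)
  qed
qed

lemma cycle_from_path:
  assumes "p \<noteq> []" "distinct p" "y \<notin> set p" "hd p \<noteq> last p"
    "successively (\<lambda>x y. {x, y} \<in> edges G) p"
    "{hd p, y} \<in> edges G" "{last p, y} \<in> edges G"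
  shows "is_cycle G (y # p)"
  unfolding is_cycle_def
proof (intro conjI allI impI)
  have "length p \<noteq> 1" using assms(4) by (cases p) auto
  then show "3 \<le> length (y # p)" using assms(1) by (cases p) (auto simp: Suc_le_eq)
  show "distinct (y # p)" using assms by simp
  fix i assume i: "i < length (y # p)"
  show "{(y # p) ! i, (y # p) ! (Suc i mod length (y # p))} \<in> edges G"
  proof (cases "Suc i = length (y # p)")
    case True
    then have "(y # p) ! i = last p" using assms(1) by (simp add: last_conv_nth nth_Cons')
    then show ?thesis using True assms(7) by simp
  next
    case False
    then have *: "Suc i mod length (y # p) = Suc i" using i by simp
    show ?thesis
    proof (cases i)
      case 0
      then show ?thesis using assms(1,6) * by (simp add: hd_conv_nth insert_commute)
    next
      case (Suc j)
      then show ?thesis using assms(5) * i False by (simp add: successively_conv_nth)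
    qed
  qed
qed

lemma finite_edges:
  assumes "finite (verts G)" "simple_graph G" shows "finite (edges G)"
proof (rule finite_subset)
  show "edges G \<subseteq> Pow (verts G)" using assms(2) unfolding simple_graph_def by blast
qed (use assms(1) in simp)

text \<open>
  Grow a connected induced subgraph with one edge less than vertices. A new vertex \<open>y\<close> brings exactly
  one edge: two edges from \<open>y\<close> would close up with a path inside the subgraph to a cycle.
\<close>

lemma tree_card_edges:
  assumes "finite (verts T)" "is_tree T"
  shows "card (verts T) = card (edges T) + 1"
proof -
  let ?V = "verts T" and ?E = "edges T"
  let ?in = "\<lambda>S. {e \<in> edges T. e \<subseteq> S}"
  let ?P = "\<lambda>S. card S = card (?in S) + 1 \<and>
               (\<forall>u\<in>S. \<forall>w\<in>S. (u, w) \<in> {(x, y). {x, y} \<in> ?in S}\<^sup>*)"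
  have simple: "simple_graph T" and acyclic: "\<nexists>c. is_cycle T c" and conn: "connected_graph T"
    using assms(2) unfolding is_tree_def by auto
  obtain r where r: "r \<in> ?V" using conn unfolding connected_graph_def by blast
  have conn': "connects ?E r ?V" using conn connected_graph_iff_connects[OF simple r] by blast
  have sub: "\<forall>e\<in>?E. e \<subseteq> ?V" using simple unfolding simple_graph_def by blast
  have "?P ?V"
  proof (rule connects_grow[OF assms(1) r conn' sub])
    have "?in {r} = {}"
      using simple unfolding simple_graph_def by (auto simp: subset_singleton_iff)
    then show "?P {r}" by simp
  next
    fix S x y
    assume S: "S \<subseteq> ?V" "?P S" "x \<in> S" "y \<in> ?V - S" "{x, y} \<in> ?E"
    have "finite S" using S(1) assms(1) by (rule finite_subset)
    have only: "z = x" if z: "z \<in> S" "{z, y} \<in> ?E" for z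
    proof (rule ccontr)
      assume "z \<noteq> x"
      have "(x, z) \<in> {(a, b). {a, b} \<in> ?in S}\<^sup>*" using S z by blast
      then obtain p where p: "p \<noteq> []" "hd p = x" "last p = z" "distinct p" "set p \<subseteq> S"
        "successively (\<lambda>a b. {a, b} \<in> ?in S) p"
        using simple_path_exists[of x z "?in S" S] S(3) by blast
      have "successively (\<lambda>a b. {a, b} \<in> ?E) p"
        using p(6) by (rule successively_mono) auto
      then have "is_cycle T (y # p)"
        using p S z \<open>z \<noteq> x\<close> by (intro cycle_from_path) auto
      then show False using acyclic by blast
    qed
    have new: "?in (insert y S) = insert {x, y} (?in S)"
    proof (intro Set.set_eqI iffI)
      fix e assume e: "e \<in> ?in (insert y S)"
      show "e \<in> insert {x, y} (?in S)"
      proof (cases "y \<in> e")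
        case True
        moreover have "card e = 2" using e simple unfolding simple_graph_def by blast
        ultimately obtain z where "e = {z, y}" "z \<noteq> y"
          by (metis card_2_iff' card_2_iff insertE insert_commute singletonD)
        then show ?thesis using e only[of z] by auto
      qed (use e in auto)
    qed (use S in auto)
    have "card (insert y S) = card (?in (insert y S)) + 1"
      using S \<open>finite S\<close> finite_edges[OF assms(1) simple] unfolding new by auto
    moreover have "(u, w) \<in> {(a, b). {a, b} \<in> ?in (insert y S)}\<^sup>*"
      if "u \<in> insert y S" "w \<in> insert y S" for u w
    proof -
      let ?R = "{(a, b). {a, b} \<in> ?in (insert y S)}"
      have mono: "{(a, b). {a, b} \<in> ?in S}\<^sup>* \<subseteq> ?R\<^sup>*" by (rule rtrancl_mono) auto
      have xy: "(x, y) \<in> ?R" "(y, x) \<in> ?R" using S by (auto simp: insert_commute)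
      have "(u, x) \<in> ?R\<^sup>*" "(x, w) \<in> ?R\<^sup>*"
        using that S(2,3) mono xy by (blast intro: r_into_rtrancl)+
      then show ?thesis by (rule rtrancl_trans)
    qed
    ultimately show "\<exists>S'. S \<subset> S' \<and> S' \<subseteq> ?V \<and> ?P S'"
      using S by (intro exI[of _ "insert y S"]) auto
  qed
  moreover have "?in ?V = ?E" using sub by blast
  ultimately show ?thesis by simp
qed

text \<open>
  Removing an edge of a cycle keeps the graph connected, and then there are too few edges.
\<close>

lemma no_cycle_if_card:
  assumes "finite (verts G)" "simple_graph G" "r \<in> verts G"
    "connects (edges G) r (verts G)" "card (edges G) + 1 = card (verts G)"
  shows "\<not> is_cycle G c"
proof
  assume c: "is_cycle G c"
  define n where "n = length c"
  define e where "e = {c ! (n - 1), c ! 0}"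
  have n: "n \<ge> 3" and dist: "distinct c"
    and cyc: "\<And>i. i < n \<Longrightarrow> {c ! i, c ! (Suc i mod n)} \<in> edges G"
    using c unfolding is_cycle_def n_def by auto
  have fin: "finite (edges G)" by (rule finite_edges[OF assms(1,2)])
  have e_in: "e \<in> edges G" using cyc[of "n - 1"] n unfolding e_def by simp
  have "connects (edges G - {e}) r (verts G)"
    unfolding connects_def
  proof (intro allI impI)
    fix S assume S: "S \<subseteq> verts G" "r \<in> S" "closed_under (edges G - {e}) S"
    have path: "c ! i \<in> S \<longleftrightarrow> c ! 0 \<in> S" if "i < n" for i
      using that
    proof (induction i)
      case (Suc i)
      have "{c ! i, c ! Suc i} \<in> edges G" using cyc[of i] Suc.prems by simp
      moreover have "{c ! i, c ! Suc i} \<noteq> e"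
      proof -
        have "c ! j = c ! k \<longleftrightarrow> j = k" if "j < n" "k < n" for j k
          using dist that unfolding n_def by (rule nth_eq_iff_index_eq)
        then show ?thesis using Suc.prems n unfolding e_def
          by (auto simp: doubleton_eq_iff)
      qed
      ultimately have "c ! i \<in> S \<longleftrightarrow> c ! Suc i \<in> S"
        using S(3) by (intro closed_under_iff[of "edges G - {e}"]) auto
      then show ?case using Suc by simp
    qed simp
    have "closed_under (edges G) S"
      unfolding closed_under_def
    proof (intro ballI allI impI)
      fix x y assume xy: "x \<in> S" "{x, y} \<in> edges G"
      show "y \<in> S"
      proof (cases "{x, y} = e")
        case True
        then show ?thesis using path[of "n - 1"] n xy(1) unfolding e_def
          by (auto simp: doubleton_eq_iff)
      next
        case False
        then show ?thesis using S(3) xy by (auto dest: closed_underD)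
      qed
    qed
    then show "S = verts G" using assms(4) S unfolding connects_def by blast
  qed
  then have "card (verts G) \<le> card (edges G - {e}) + 1"
    using assms(1,2,3) fin by (intro card_le_card_edges) (auto simp: simple_graph_def)
  moreover have "card (edges G - {e}) + 1 = card (edges G)"
    using fin e_in by (metis Suc_eq_plus1 card_Suc_Diff1)
  ultimately show False using assms(5) by linarith
qed

lemma even_card_involution:
  assumes "finite A" "\<And>x. x \<in> A \<Longrightarrow> h x \<in> A \<and> h (h x) = x \<and> h x \<noteq> x"
  shows "even (card A)"
proof -
  let ?C = "(\<lambda>x. {x, h x}) ` A"
  have un: "\<Union>?C = A" using assms(2) by auto
  have "2 dvd card (\<Union>?C)"
  proof (rule dvd_partition)
    show "finite (\<Union>?C)" using un assms(1) by simp
    have "card {x, h x} = 2" if "x \<in> A" for x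
      using assms(2)[OF that] by (metis card_2_iff)
    then show "\<forall>c\<in>?C. 2 dvd card c" by simp
    have "{x, h x} = {y, h y}" if "x \<in> A" "y \<in> A" "z \<in> {x, h x}" "z \<in> {y, h y}" for x y z
    proof -
      have "y = x \<or> y = h x"
        using that assms(2) by (metis insertE singletonD)
      then show ?thesis
        using assms(2)[OF that(1)] by (elim disjE) (simp_all add: insert_commute)
    qed
    then show "\<forall>c1\<in>?C. \<forall>c2\<in>?C. c1 \<noteq> c2 \<longrightarrow> c1 \<inter> c2 = {}"
      by blast
  qed
  then show ?thesis unfolding un .
qed

lemma is_tree_iff_card:
  assumes "finite (verts T)" "simple_graph T" "r \<in> verts T"
  shows "is_tree T \<longleftrightarrow> connects (edges T) r (verts T) \<and> card (edges T) + 1 = card (verts T)"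
proof
  assume "is_tree T"
  then show "connects (edges T) r (verts T) \<and> card (edges T) + 1 = card (verts T)"
    using tree_card_edges[OF assms(1)] connected_graph_iff_connects[OF assms(2,3)]
    by (simp add: is_tree_def)
next
  assume "connects (edges T) r (verts T) \<and> card (edges T) + 1 = card (verts T)"
  then show "is_tree T"
    using no_cycle_if_card[OF assms] connected_graph_iff_connects[OF assms(2,3)] assms(2)
    by (auto simp: is_tree_def)
qed

section \<open>Involutions with a single fixed vertex\<close>

text \<open>
  In the quotient by such an \<open>s\<close>, the vertex \<open>r\<close> is the only one that is not covered twice.
\<close>

locale half_turn =
  fixes s :: "'v \<Rightarrow> 'v" and r :: 'v and V :: "'v set"
  assumes finite_V: "finite V"
    and root: "r \<in> V"
    and s_in: "x \<in> V \<Longrightarrow> s x \<in> V"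
    and s_s: "x \<in> V \<Longrightarrow> s (s x) = x"
    and s_fix: "x \<in> V \<Longrightarrow> s x = x \<longleftrightarrow> x = r"

text \<open>
  Free in the sense of group actions: the involution acts on the edges without fixed points.
\<close>

definition free_edges :: "('v \<Rightarrow> 'v) \<Rightarrow> 'v set \<Rightarrow> 'v set set \<Rightarrow> bool" where
  "free_edges s V E \<longleftrightarrow> (\<forall>e\<in>E. e \<subseteq> V \<and> card e = 2 \<and> s ` e \<in> E \<and> s ` e \<noteq> e)"

text \<open>
  For a symmetric set of edges this is connectedness of the quotient graph; it amounts to
  connectedness of the graph itself, because a path to \<open>r\<close> in the quotient lifts to paths to \<open>r\<close> from
  both vertices of an orbit.
\<close>

definition inv_connects :: "('v \<Rightarrow> 'v) \<Rightarrow> 'v set set \<Rightarrow> 'v \<Rightarrow> 'v set \<Rightarrow> bool" where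
  "inv_connects s E r V \<longleftrightarrow>
     (\<forall>S\<subseteq>V. r \<in> S \<longrightarrow> s ` S \<subseteq> S \<longrightarrow> closed_under E S \<longrightarrow> S = V)"

definition edge_orbit :: "('v \<Rightarrow> 'v) \<Rightarrow> 'v \<Rightarrow> 'v \<Rightarrow> 'v set set" where
  "edge_orbit s x y = {{x, y}, {s x, s y}}"

definition nbrs :: "'v set set \<Rightarrow> 'v \<Rightarrow> 'v set" where
  "nbrs E v = {w. {v, w} \<in> E}"

definition induced :: "'v set set \<Rightarrow> 'v set \<Rightarrow> 'v set set" where
  "induced E U = {e \<in> E. e \<subseteq> U}"

lemma free_edgesD:
  assumes "free_edges s V E" "e \<in> E"
  shows "e \<subseteq> V" "card e = 2" "s ` e \<in> E" "s ` e \<noteq> e"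
  using bspec[OF assms(1)[unfolded free_edges_def] assms(2)] by auto

lemma inv_connectsD:
  "inv_connects s E r V \<Longrightarrow> S \<subseteq> V \<Longrightarrow> r \<in> S \<Longrightarrow> s ` S \<subseteq> S \<Longrightarrow> closed_under E S \<Longrightarrow> S = V"
  unfolding inv_connects_def by simp

lemma closed_under_Un: "closed_under (E \<union> F) S \<longleftrightarrow> closed_under E S \<and> closed_under F S"
  unfolding closed_under_def by blast

lemma induced_Un: "induced (E \<union> F) U = induced E U \<union> induced F U"
  by (auto simp: induced_def)

lemma induced_subset: "induced E U \<subseteq> E"
  by (auto simp: induced_def)

lemma induced_edge_iff: "{x, y} \<in> induced E U \<longleftrightarrow> {x, y} \<in> E \<and> x \<in> U \<and> y \<in> U"
  by (auto simp: induced_def)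

lemma nbrs_Un: "nbrs (E \<union> F) v = nbrs E v \<union> nbrs F v"
  by (auto simp: nbrs_def)

lemma free_edges_not_subset_singleton:
  assumes "free_edges s V E" "e \<in> E"
  shows "\<not> e \<subseteq> {x}"
  using card_mono[of "{x}" e] free_edgesD(2)[OF assms] by auto

context half_turn
begin

lemma s_root: "s r = r"
  using root s_fix by blast

lemma s_root_iff: "x \<in> V \<Longrightarrow> s x = r \<longleftrightarrow> x = r"
  using s_root s_s by metis

lemma s_eq_iff: "x \<in> V \<Longrightarrow> y \<in> V \<Longrightarrow> s x = s y \<longleftrightarrow> x = y"
  using s_s by metis

lemma s_swap: "x \<in> V \<Longrightarrow> y \<in> V \<Longrightarrow> x = s y \<longleftrightarrow> y = s x"
  using s_s by metis

lemma inv_iff: "S \<subseteq> V \<Longrightarrow> s ` S \<subseteq> S \<Longrightarrow> x \<in> V \<Longrightarrow> s x \<in> S \<longleftrightarrow> x \<in> S"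
  using s_s by (metis image_subset_iff)

lemma free_edgesI:
  assumes "\<And>e. e \<in> E \<Longrightarrow> \<exists>x y. e = {x, y} \<and> x \<in> V \<and> y \<in> V \<and> x \<noteq> y \<and> y \<noteq> s x \<and> {s x, s y} \<in> E"
  shows "free_edges s V E"
  unfolding free_edges_def
proof (intro ballI)
  fix e assume "e \<in> E"
  then obtain x y where e: "e = {x, y}" "x \<in> V" "y \<in> V" "x \<noteq> y" "y \<noteq> s x" "{s x, s y} \<in> E"
    using assms by blast
  then have "{s x, s y} \<noteq> {x, y}"
    using s_fix by (metis doubleton_eq_iff)
  then show "e \<subseteq> V \<and> card e = 2 \<and> s ` e \<in> E \<and> s ` e \<noteq> e"
    using e by simp
qed

lemma free_edges_nbr:
  assumes "free_edges s V E" "{x, y} \<in> E"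
  shows "x \<in> V" "y \<in> V" "x \<noteq> y" "y \<noteq> s x" "x \<noteq> s y" "{s x, s y} \<in> E"
proof -
  from free_edgesD[OF assms] have *: "{x, y} \<subseteq> V" "card {x, y} = 2" "{s x, s y} \<in> E" "{s x, s y} \<noteq> {x, y}"
    by simp_all
  then show "x \<in> V" "y \<in> V" "x \<noteq> y" "{s x, s y} \<in> E" by auto
  show "y \<noteq> s x" "x \<noteq> s y" using * s_s by (auto simp: insert_commute)
qed

lemma free_edges_cases:
  assumes "free_edges s V E" "e \<in> E"
  obtains x y where "e = {x, y}"
  using free_edgesD(2)[OF assms] by (metis card_2_iff)

lemma edge_s_iff:
  assumes "free_edges s V E" "x \<in> V" "y \<in> V"
  shows "{s x, s y} \<in> E \<longleftrightarrow> {x, y} \<in> E"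
  using free_edges_nbr(6)[OF assms(1)] s_s assms(2,3) by metis

lemma edge_s_swap:
  assumes "free_edges s V E" "x \<in> V" "y \<in> V"
  shows "{s x, y} \<in> E \<longleftrightarrow> {x, s y} \<in> E"
  using edge_s_iff[OF assms(1,2), of "s y"] s_in s_s assms(3) by metis

lemma free_edges_Un: "free_edges s V E \<Longrightarrow> free_edges s V F \<Longrightarrow> free_edges s V (E \<union> F)"
  unfolding free_edges_def by (simp add: ball_Un)

lemma free_edges_orbit:
  assumes "x \<in> V" "y \<in> V" "x \<noteq> y" "y \<noteq> s x"
  shows "free_edges s V (edge_orbit s x y)"
proof (rule free_edgesI)
  fix e assume "e \<in> edge_orbit s x y"
  then consider "e = {x, y}" | "e = {s x, s y}" unfolding edge_orbit_def by blast
  then show "\<exists>x' y'. e = {x', y'} \<and> x' \<in> V \<and> y' \<in> V \<and> x' \<noteq> y' \<and> y' \<noteq> s x' \<and>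
      {s x', s y'} \<in> edge_orbit s x y"
  proof cases
    case 1
    then show ?thesis using assms by (intro exI[of _ x] exI[of _ y]) (simp add: edge_orbit_def)
  next
    case 2
    then show ?thesis using assms
      by (intro exI[of _ "s x"] exI[of _ "s y"]) (simp add: edge_orbit_def s_in s_s s_eq_iff s_swap)
  qed
qed

lemma free_edges_Diff_orbit:
  assumes "free_edges s V E" "x \<in> V" "y \<in> V"
  shows "free_edges s V (E - edge_orbit s x y)"
  unfolding free_edges_def
proof (intro ballI)
  fix e assume e: "e \<in> E - edge_orbit s x y"
  then have *: "e \<subseteq> V \<and> card e = 2 \<and> s ` e \<in> E \<and> s ` e \<noteq> e"
    using free_edgesD[OF assms(1)] by simp
  have "s ` s ` e = e" using * s_s by (force simp: image_image)
  then have "s ` e \<notin> edge_orbit s x y"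
    using e assms(2,3) s_s unfolding edge_orbit_def by auto
  then show "e \<subseteq> V \<and> card e = 2 \<and> s ` e \<in> E - edge_orbit s x y \<and> s ` e \<noteq> e"
    using * by blast
qed

lemma free_edges_induced:
  assumes "free_edges s V E" "s ` U \<subseteq> U"
  shows "free_edges s U (induced E U)"
  unfolding free_edges_def
proof (intro ballI)
  fix e assume "e \<in> induced E U"
  then have e: "e \<in> E" "e \<subseteq> U" by (simp_all add: induced_def)
  moreover have "s ` e \<subseteq> U" using e(2) assms(2) by blast
  ultimately show "e \<subseteq> U \<and> card e = 2 \<and> s ` e \<in> induced E U \<and> s ` e \<noteq> e"
    using free_edgesD[OF assms(1) e(1)] by (simp add: induced_def)
qed

lemma orbit_notin:
  assumes "free_edges s V E" "x \<in> V" "y \<in> V" "{x, y} \<notin> E"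
  shows "edge_orbit s x y \<inter> E = {}"
  using edge_s_iff[OF assms(1-3)] assms(4) unfolding edge_orbit_def by simp

lemma orbit_subset:
  assumes "free_edges s V E" "{x, y} \<in> E"
  shows "edge_orbit s x y \<subseteq> E"
  using free_edges_nbr(6)[OF assms] assms(2) unfolding edge_orbit_def by simp

lemma card_orbit:
  assumes "x \<in> V" "y \<in> V" "x \<noteq> y" "y \<noteq> s x"
  shows "card (edge_orbit s x y) = 2"
proof -
  have "{s x, s y} \<noteq> {x, y}" using assms s_fix by (metis doubleton_eq_iff)
  then show ?thesis unfolding edge_orbit_def by (auto simp: card_2_iff)
qed

lemma closed_under_orbit:
  assumes "S \<subseteq> V" "s ` S \<subseteq> S" "x \<in> V" "y \<in> V" "x \<in> S \<longleftrightarrow> y \<in> S"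
  shows "closed_under (edge_orbit s x y) S"
proof -
  have "s x \<in> S \<longleftrightarrow> s y \<in> S" using assms by (simp add: inv_iff)
  then show ?thesis using assms(5)
    unfolding closed_under_def edge_orbit_def by (auto simp: doubleton_eq_iff)
qed

lemma finite_free_edges: "free_edges s V E \<Longrightarrow> finite E"
  by (rule finite_subset[of _ "Pow V"]) (auto simp: free_edges_def finite_V)

lemma finite_nbrs: "free_edges s V E \<Longrightarrow> finite (nbrs E v)"
  by (rule finite_subset[OF _ finite_V]) (auto simp: nbrs_def dest: free_edges_nbr)

text \<open>
  A closed set \<open>S\<close> containing \<open>r\<close> yields the closed and invariant set of the vertices whose orbit
  lies in \<open>S\<close>; if that is everything, so is \<open>S\<close>.
\<close>

lemma inv_connects_imp_connects:
  assumes "free_edges s V E" "inv_connects s E r V"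
  shows "connects E r V"
  unfolding connects_def
proof (intro allI impI)
  fix S assume S: "S \<subseteq> V" "r \<in> S" "closed_under E S"
  let ?I = "S \<inter> {x \<in> V. s x \<in> S}"
  have "closed_under E ?I"
    unfolding closed_under_def
  proof (intro ballI allI impI)
    fix x y assume x: "x \<in> ?I" and e: "{x, y} \<in> E"
    then show "y \<in> ?I"
      using closed_underD[OF S(3) e] closed_underD[OF S(3) free_edges_nbr(6)[OF assms(1) e]]
        free_edges_nbr(2)[OF assms(1) e] by blast
  qed
  moreover have "s ` ?I \<subseteq> ?I" using s_in s_s by auto
  ultimately have "?I = V"
    using S s_root root by (intro inv_connectsD[OF assms(2)]) auto
  then show "S = V" using S(1) by blast
qed

lemma card_le_card_free_edges:
  assumes "free_edges s V E" "inv_connects s E r V"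
  shows "card V \<le> card E + 1"
  using card_le_card_edges[OF finite_V finite_free_edges root inv_connects_imp_connects] assms
    free_edgesD(1)[OF assms(1)] by simp

text \<open>
  Both sides count the incidences between vertices and edges.
\<close>

lemma degree_sum:
  assumes "free_edges s V E"
  shows "(\<Sum>v\<in>V. card (nbrs E v)) = 2 * card E"
proof -
  have "card (nbrs E v) = card {e \<in> E. v \<in> e}" for v
  proof (rule bij_betw_same_card)
    show "bij_betw (\<lambda>w. {v, w}) (nbrs E v) {e \<in> E. v \<in> e}"
      unfolding bij_betw_def
    proof
      show "inj_on (\<lambda>w. {v, w}) (nbrs E v)" by (auto simp: inj_on_def doubleton_eq_iff)
      show "(\<lambda>w. {v, w}) ` nbrs E v = {e \<in> E. v \<in> e}"
      proof
        show "(\<lambda>w. {v, w}) ` nbrs E v \<subseteq> {e \<in> E. v \<in> e}" by (auto simp: nbrs_def)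
        show "{e \<in> E. v \<in> e} \<subseteq> (\<lambda>w. {v, w}) ` nbrs E v"
        proof
          fix e assume "e \<in> {e \<in> E. v \<in> e}"
          then have e: "e \<in> E" "v \<in> e" by auto
          obtain x y where "e = {x, y}" by (rule free_edges_cases[OF assms e(1)])
          then have "\<exists>w. e = {v, w}" using e(2) by (auto simp: insert_commute)
          then show "e \<in> (\<lambda>w. {v, w}) ` nbrs E v" using e(1) by (auto simp: nbrs_def)
        qed
      qed
    qed
  qed
  then have "(\<Sum>v\<in>V. card (nbrs E v)) = (\<Sum>v\<in>V. card {e \<in> E. v \<in> e})" by simp
  also have "\<dots> = (\<Sum>e\<in>E. 2)"
  proof (rule sum_multicount_gen[OF finite_V finite_free_edges[OF assms]])
    show "\<forall>e\<in>E. card {v \<in> V. v \<in> e} = 2"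
    proof
      fix e assume e: "e \<in> E"
      then have "{v \<in> V. v \<in> e} = e" using free_edgesD(1)[OF assms e] by blast
      then show "card {v \<in> V. v \<in> e} = 2" using free_edgesD(2)[OF assms e] by simp
    qed
  qed
  finally show ?thesis by simp
qed

lemma nbrs_s:
  assumes "free_edges s V E" "v \<in> V"
  shows "nbrs E (s v) = s ` nbrs E v"
proof (intro Set.set_eqI iffI)
  fix w assume "w \<in> nbrs E (s v)"
  then have e: "{s v, w} \<in> E" by (simp add: nbrs_def)
  then have w: "w \<in> V" using free_edges_nbr(2)[OF assms(1)] by blast
  then have "s w \<in> nbrs E v" using e edge_s_swap[OF assms w] by (simp add: nbrs_def)
  then show "w \<in> s ` nbrs E v" using s_s[OF w] by (metis imageI)
next
  fix w assume "w \<in> s ` nbrs E v"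
  then show "w \<in> nbrs E (s v)" using free_edges_nbr(6)[OF assms(1)] by (auto simp: nbrs_def)
qed

end

section \<open>Deleting an orbit of vertices\<close>

context half_turn
begin

lemma half_turn_subset:
  assumes "V' \<subseteq> V" "r \<in> V'" "s ` V' \<subseteq> V'"
  shows "half_turn s r V'"
  using assms finite_V s_s s_fix by unfold_locales (auto intro: finite_subset)

lemma half_turn_delete:
  assumes "v \<in> V" "v \<noteq> r"
  shows "half_turn s r (V - {v, s v})" "s ` (V - {v, s v}) \<subseteq> V - {v, s v}"
proof -
  show "s ` (V - {v, s v}) \<subseteq> V - {v, s v}" using assms s_in s_s by auto metis+
  then show "half_turn s r (V - {v, s v})"
    using assms root s_root_iff by (intro half_turn_subset) auto
qed

lemma card_delete:
  assumes "v \<in> V" "v \<noteq> r"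
  shows "card V = card (V - {v, s v}) + 2"
proof -
  have "card {v, s v} = 2" using s_fix assms by (auto simp: card_2_iff)
  moreover have "{v, s v} \<subseteq> V" using s_in assms by blast
  ultimately show ?thesis
    using finite_V by (metis card_Diff_subset card_mono finite_subset le_add_diff_inverse2)
qed

lemma edges_split:
  assumes "free_edges s V E" "v \<in> V"
  shows "E = induced E (V - {v, s v}) \<union> (\<lambda>w. {v, w}) ` nbrs E v \<union> (\<lambda>w. s ` {v, w}) ` nbrs E v"
proof (intro Set.set_eqI iffI)
  fix e assume e: "e \<in> E"
  obtain x y where xy: "e = {x, y}" using free_edges_cases[OF assms(1) e] .
  have V: "x \<in> V" "y \<in> V" using free_edges_nbr[OF assms(1)] e xy by blast+
  have s: "\<exists>w \<in> nbrs E v. e = s ` {v, w}" if "e = {s v, z}" "z \<in> V" for z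
  proof
    show "e = s ` {v, s z}" using that s_s by simp
    show "s z \<in> nbrs E v"
      using that e edge_s_swap[OF assms] unfolding nbrs_def by simp
  qed
  consider "x = v" | "y = v" | "x = s v" | "y = s v" | "e \<subseteq> V - {v, s v}" using V xy by auto
  then show "e \<in> induced E (V - {v, s v}) \<union> (\<lambda>w. {v, w}) ` nbrs E v \<union> (\<lambda>w. s ` {v, w}) ` nbrs E v"
  proof cases
    case 1 then show ?thesis using e xy by (auto simp: nbrs_def)
  next
    case 2
    then have "e = {v, x}" using xy by auto
    then show ?thesis using e by (auto simp: nbrs_def)
  next
    case 3 then show ?thesis using s[of y] xy V by blast
  next
    case 4
    then have "e = {s v, x}" using xy by auto
    then show ?thesis using s[of x] V by blast
  next
    case 5 then show ?thesis using e by (simp add: induced_def)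
  qed
next
  fix e assume "e \<in> induced E (V - {v, s v}) \<union> (\<lambda>w. {v, w}) ` nbrs E v \<union> (\<lambda>w. s ` {v, w}) ` nbrs E v"
  then show "e \<in> E"
    using free_edges_nbr(6)[OF assms(1)] unfolding induced_def nbrs_def by auto
qed

lemma card_edges_delete:
  assumes "free_edges s V E" "v \<in> V" "v \<noteq> r"
  shows "card E = card (induced E (V - {v, s v})) + 2 * card (nbrs E v)"
proof -
  let ?A = "induced E (V - {v, s v})"
  let ?B = "(\<lambda>w. {v, w}) ` nbrs E v"
  let ?C = "(\<lambda>w. s ` {v, w}) ` nbrs E v"
  note nb = free_edges_nbr[OF assms(1)]
  have fin: "finite ?A" "finite ?B" "finite ?C"
    using finite_free_edges[OF assms(1)] finite_nbrs[OF assms(1)] by (auto simp: induced_def)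
  have inj: "inj_on (\<lambda>w. {v, w}) (nbrs E v)"
    by (auto simp: inj_on_def doubleton_eq_iff)
  have inj_s: "inj_on (\<lambda>w. s ` {v, w}) (nbrs E v)"
    using nb s_eq_iff by (auto simp: inj_on_def doubleton_eq_iff nbrs_def)
  have "{v, w} \<noteq> s ` {v, w'}" if "w \<in> nbrs E v" "w' \<in> nbrs E v" for w w'
    using nb(4)[of v w] that s_fix[OF assms(2)] assms(3)
    by (auto simp: nbrs_def doubleton_eq_iff)
  then have "?B \<inter> ?C = {}" by blast
  moreover have "?A \<inter> ?B = {}" "?A \<inter> ?C = {}" by (auto simp: induced_def)
  ultimately have "?A \<inter> ?B = {}" "(?A \<union> ?B) \<inter> ?C = {}" by blast+
  then have "card (?A \<union> ?B \<union> ?C) = card ?A + card ?B + card ?C"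
    using fin by (simp add: card_Un_disjoint)
  also have "\<dots> = card ?A + 2 * card (nbrs E v)"
    using card_image[OF inj] card_image[OF inj_s] by linarith
  finally show ?thesis using edges_split[OF assms(1,2)] by simp
qed

lemma nbrs_nonempty:
  assumes "free_edges s V E" "inv_connects s E r V" "v \<in> V" "v \<noteq> r"
  shows "nbrs E v \<noteq> {}"
proof
  assume empty: "nbrs E v = {}"
  have "closed_under E (V - {v, s v})"
    unfolding closed_under_def
  proof (intro ballI allI impI)
    fix x y assume xy: "x \<in> V - {v, s v}" "{x, y} \<in> E"
    have "y \<noteq> v" using empty xy by (auto simp: nbrs_def insert_commute)
    moreover have "y \<noteq> s v"
    proof
      assume "y = s v"
      then have "{v, s x} \<in> E" using edge_s_swap[OF assms(1), of v x] xy assms(3)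
        by (simp add: insert_commute)
      then show False using empty by (auto simp: nbrs_def)
    qed
    ultimately show "y \<in> V - {v, s v}" using free_edges_nbr(2)[OF assms(1) xy(2)] by blast
  qed
  moreover have "r \<in> V - {v, s v}" using root s_root_iff assms by auto
  ultimately have "V - {v, s v} = V"
    using half_turn_delete(2)[OF assms(3,4)] by (intro inv_connectsD[OF assms(2)]) auto
  then show False using assms(3) by blast
qed

text \<open>
  To see that \<open>F\<close> connects what is left after deleting the orbit of \<open>v\<close>, it is enough that a set closed
  under \<open>F\<close> does not separate the neighbours of \<open>v\<close>: it can then be completed by the orbit of \<open>v\<close>, or
  left as it is, to a set closed under \<open>E\<close>.
\<close>

lemma inv_connects_delete:
  assumes "free_edges s V E" "inv_connects s E r V" "v \<in> V" "v \<noteq> r"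
    and key: "\<And>S. \<lbrakk>S \<subseteq> V - {v, s v}; r \<in> S; s ` S \<subseteq> S; closed_under F S\<rbrakk> \<Longrightarrow>
      closed_under (induced E (V - {v, s v})) S \<and> (nbrs E v \<subseteq> S \<or> nbrs E v \<inter> S = {})"
  shows "inv_connects s F r (V - {v, s v})"
  unfolding inv_connects_def
proof (intro allI impI)
  fix S assume S: "S \<subseteq> V - {v, s v}" "r \<in> S" "s ` S \<subseteq> S" "closed_under F S"
  \<comment> \<open>The orbit of \<open>v\<close> joins the side on which its neighbours
    lie.\<close>
  let ?T = "S \<union> (if nbrs E v \<subseteq> S then {v, s v} else {})"
  have ind: "closed_under (induced E (V - {v, s v})) S" and nb: "nbrs E v \<subseteq> S \<or> nbrs E v \<inter> S = {}"
    using key[OF S] by auto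
  have SV: "S \<subseteq> V" using S(1) by blast
  have "closed_under E ?T"
    unfolding closed_under_def
  proof (intro ballI allI impI)
    fix x y assume x: "x \<in> ?T" and e: "{x, y} \<in> E"
    note xy = free_edges_nbr[OF assms(1) e]
    have nv: "w \<in> S \<Longrightarrow> nbrs E v \<subseteq> S" if "{v, w} \<in> E" for w
      using that nb by (auto simp: nbrs_def)
    consider "x = v" "nbrs E v \<subseteq> S" | "x = s v" "nbrs E v \<subseteq> S" | "x \<in> S" "y \<in> {v, s v}"
      | "x \<in> S" "y \<notin> {v, s v}"
      using x by (auto split: if_splits)
    then show "y \<in> ?T"
    proof cases
      case 1
      then show ?thesis using e by (auto simp: nbrs_def)
    next
      case 2
      then have "s y \<in> nbrs E v"
        using e edge_s_swap[OF assms(1,3) xy(2)] by (simp add: nbrs_def)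
      then have "s y \<in> S" using 2 by blast
      then show ?thesis using inv_iff[OF SV S(3) xy(2)] by blast
    next
      case 3
      have "nbrs E v \<subseteq> S"
      proof (cases "y = v")
        case True
        then show ?thesis using nv[of x] 3 e by (simp add: insert_commute)
      next
        case False
        then have "{v, s x} \<in> E"
          using 3 e edge_s_swap[OF assms(1,3) xy(1)] by (simp add: insert_commute)
        then show ?thesis using nv[of "s x"] 3 S(3) by blast
      qed
      then show ?thesis using 3 by auto
    next
      case 4
      then have "{x, y} \<in> induced E (V - {v, s v})"
        using e xy S(1) by (auto simp: induced_def)
      then show ?thesis using ind 4 by (auto dest: closed_underD)
    qed
  qed
  moreover have "s ` ?T \<subseteq> ?T" using S(3) s_s[OF assms(3)] by auto
  moreover have "?T \<subseteq> V" using SV assms(3) s_in by auto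
  ultimately have "?T = V" using S(2) by (intro inv_connectsD[OF assms(2)]) auto
  then show "S = V - {v, s v}" using S(1) by (auto split: if_splits)
qed

end

section \<open>Pairs of symmetric trees\<close>

definition sym_tree :: "('v \<Rightarrow> 'v) \<Rightarrow> 'v \<Rightarrow> 'v set \<Rightarrow> 'v set set \<Rightarrow> bool" where
  "sym_tree s r V E \<longleftrightarrow> free_edges s V E \<and> inv_connects s E r V \<and> card E + 1 = card V"

context half_turn
begin

text \<open>
  A tree has too few edges to stay connected without the orbit of an edge. The set \<open>S\<close> witnesses
  the separation, and it must separate the ends of the edge, or else it would be closed under \<open>E\<close>.
\<close>

lemma bridge:
  assumes "sym_tree s r V E" "{x, y} \<in> E"
  obtains S where "S \<subseteq> V" "r \<in> S" "s ` S \<subseteq> S" "closed_under (E - edge_orbit s x y) S"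
    "(x \<in> S) \<noteq> (y \<in> S)"
proof -
  have free: "free_edges s V E" and conn: "inv_connects s E r V" and card: "card E + 1 = card V"
    using assms(1) unfolding sym_tree_def by auto
  have xy: "x \<in> V" "y \<in> V" using free_edges_nbr[OF free assms(2)] by auto
  have free': "free_edges s V (E - edge_orbit s x y)"
    by (rule free_edges_Diff_orbit[OF free xy])
  have "E - edge_orbit s x y \<subset> E" using assms(2) by (auto simp: edge_orbit_def)
  then have "card (E - edge_orbit s x y) < card E"
    by (rule psubset_card_mono[OF finite_free_edges[OF free]])
  then have "\<not> inv_connects s (E - edge_orbit s x y) r V"
    using card card_le_card_free_edges[OF free'] by linarith
  then obtain S where S: "S \<subseteq> V" "r \<in> S" "s ` S \<subseteq> S" "closed_under (E - edge_orbit s x y) S" "S \<noteq> V"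
    unfolding inv_connects_def by auto
  have "(x \<in> S) \<noteq> (y \<in> S)"
  proof
    assume "(x \<in> S) = (y \<in> S)"
    then have "closed_under (edge_orbit s x y) S"
      by (rule closed_under_orbit[OF S(1,3) xy])
    then have "closed_under ((E - edge_orbit s x y) \<union> edge_orbit s x y) S"
      unfolding closed_under_Un using S(4) by blast
    moreover have "(E - edge_orbit s x y) \<union> edge_orbit s x y = E"
      using orbit_subset[OF free assms(2)] by blast
    ultimately show False using inv_connectsD[OF conn S(1-3)] S(5) by simp
  qed
  then show ?thesis using that S by blast
qed

text \<open>
  In the quotient the two edges would be parallel, and a tree has no parallel edges.
\<close>

lemma no_parallel:
  assumes "sym_tree s r V E" "x \<noteq> r" "y \<noteq> r" "{x, y} \<in> E"
  shows "{x, s y} \<notin> E"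
proof
  assume e: "{x, s y} \<in> E"
  obtain S where S: "S \<subseteq> V" "s ` S \<subseteq> S" "closed_under (E - edge_orbit s x y) S"
    "(x \<in> S) \<noteq> (y \<in> S)" by (rule bridge[OF assms(1,4)])
  have free: "free_edges s V E" using assms(1) unfolding sym_tree_def by auto
  note xy = free_edges_nbr[OF free assms(4)]
  have "s x \<noteq> x" "s y \<noteq> y" using s_fix assms(2,3) xy(1,2) by auto
  then have "{x, s y} \<notin> edge_orbit s x y"
    using xy(5) by (auto simp: edge_orbit_def doubleton_eq_iff)
  then have "x \<in> S \<longleftrightarrow> s y \<in> S"
    using e by (intro closed_under_iff[OF S(3)]) simp
  then show False using S(4) inv_iff[OF S(1,2) xy(2)] by blast
qed

text \<open>
  In the quotient the three edges would form a triangle.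
\<close>

lemma no_triangle:
  assumes "sym_tree s r V E" "{x, y} \<in> E" "{x, z} \<in> E" "y \<noteq> z" "z' = z \<or> z' = s z"
  shows "{y, z'} \<notin> E"
proof
  assume e: "{y, z'} \<in> E"
  obtain S where S: "S \<subseteq> V" "s ` S \<subseteq> S" "closed_under (E - edge_orbit s y z') S"
    "(y \<in> S) \<noteq> (z' \<in> S)" by (rule bridge[OF assms(1) e])
  have free: "free_edges s V E" using assms(1) unfolding sym_tree_def by auto
  note xy = free_edges_nbr[OF free assms(2)] and xz = free_edges_nbr[OF free assms(3)]
  have "x \<noteq> z'" "x \<noteq> s z'" using assms(5) xz s_s by auto
  then have "{x, y} \<notin> edge_orbit s y z'" "{x, z} \<notin> edge_orbit s y z'"
    using xy(3,5) by (auto simp: edge_orbit_def doubleton_eq_iff)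
  then have "x \<in> S \<longleftrightarrow> y \<in> S" "x \<in> S \<longleftrightarrow> z \<in> S"
    using assms(2,3) by (auto intro!: closed_under_iff[OF S(3)])
  moreover have "z' \<in> S \<longleftrightarrow> z \<in> S" using assms(5) inv_iff[OF S(1,2) xz(2)] by blast
  ultimately show False using S(4) by blast
qed

end

locale tree_pair = half_turn s r V for s :: "'v \<Rightarrow> 'v" and r V +
  fixes E\<^sub>1 E\<^sub>2 :: "'v set set"
  assumes tree1: "sym_tree s r V E\<^sub>1" and tree2: "sym_tree s r V E\<^sub>2"
    and disjoint: "E\<^sub>1 \<inter> E\<^sub>2 = {}"

text \<open>
  Connectedness bounds the size of either set from below, so their joint size forces both to be
  trees.
\<close>

lemma tree_pairI:
  assumes "half_turn s r V" "free_edges s V E\<^sub>1" "free_edges s V E\<^sub>2"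
    "inv_connects s E\<^sub>1 r V" "inv_connects s E\<^sub>2 r V" "E\<^sub>1 \<inter> E\<^sub>2 = {}"
    "card (E\<^sub>1 \<union> E\<^sub>2) + 2 = 2 * card V"
  shows "tree_pair s r V E\<^sub>1 E\<^sub>2"
proof -
  interpret half_turn s r V by fact
  have "card (E\<^sub>1 \<union> E\<^sub>2) = card E\<^sub>1 + card E\<^sub>2"
    using assms(2,3,6) by (intro card_Un_disjoint finite_free_edges) auto
  moreover have "card V \<le> card E\<^sub>1 + 1" "card V \<le> card E\<^sub>2 + 1"
    using assms card_le_card_free_edges by auto
  ultimately have "card E\<^sub>1 + 1 = card V" "card E\<^sub>2 + 1 = card V"
    using assms(7) by linarith+
  then show ?thesis using assms by unfold_locales (auto simp: sym_tree_def)
qed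

lemma tree_pair_swap: "tree_pair s r V E\<^sub>1 E\<^sub>2 \<Longrightarrow> tree_pair s r V E\<^sub>2 E\<^sub>1"
  unfolding tree_pair_def tree_pair_axioms_def by auto

section \<open>Undoing 0-extensions and 1-extensions\<close>

text \<open>
  One step of the construction, read backwards. The graph whose only vertex is \<open>r\<close> is excluded because
  it is not the union of two distinct trees.
\<close>

definition reducible :: "('v \<Rightarrow> 'v) \<Rightarrow> 'v \<Rightarrow> 'v set \<Rightarrow> 'v set set \<Rightarrow> bool" where
  "reducible s r V E \<longleftrightarrow> (\<exists>V' F\<^sub>1 F\<^sub>2. tree_pair s r V' F\<^sub>1 F\<^sub>2 \<and> V' \<subset> V \<and> V' \<noteq> {r} \<and>
     allowable_extension s \<lparr>verts = V', edges = F\<^sub>1 \<union> F\<^sub>2\<rparr> \<lparr>verts = V, edges = E\<rparr>)"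

context half_turn
begin

lemma simple_graph_of: "free_edges s V E \<Longrightarrow> simple_graph \<lparr>verts = V, edges = E\<rparr>"
  unfolding simple_graph_def by (simp add: free_edges_def)

lemma z2_symmetric_of:
  assumes "free_edges s V E"
  shows "z2_symmetric s \<lparr>verts = V, edges = E\<rparr>"
proof -
  have "bij_betw (restrict s V) V V"
    by (rule bij_betw_byWitness[where f' = s]) (auto simp: s_in s_s)
  then have "restrict s V \<in> Bij V" by (simp add: Bij_def)
  then show ?thesis
    unfolding z2_symmetric_def graph_auts_def
    by (auto simp: s_in edge_s_iff[OF assms])
qed

end

lemma symmetric_pairI:
  assumes "half_turn s r V'" "half_turn s r V" "free_edges s V' F" "free_edges s V E"
  shows "symmetric_pair s \<lparr>verts = V', edges = F\<rparr> \<lparr>verts = V, edges = E\<rparr>"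
  unfolding symmetric_pair_def
  by (intro conjI half_turn.simple_graph_of[OF assms(1,3)] half_turn.simple_graph_of[OF assms(2,4)]
      half_turn.z2_symmetric_of[OF assms(1,3)] half_turn.z2_symmetric_of[OF assms(2,4)])

context half_turn
begin

lemma nbrs_in_delete:
  assumes "free_edges s V E" "v \<in> V"
  shows "nbrs E v \<subseteq> V - {v, s v}"
proof
  fix w assume "w \<in> nbrs E v"
  then have "{v, w} \<in> E" by (simp add: nbrs_def)
  then show "w \<in> V - {v, s v}" using free_edges_nbr[OF assms(1)] by blast
qed

lemma adds_vertex_orbit_delete:
  assumes "v \<in> V" "v \<noteq> r"
  shows "adds_vertex_orbit s \<lparr>verts = V - {v, s v}, edges = F\<rparr> \<lparr>verts = V, edges = E\<rparr> v"
  using assms s_in[OF assms(1)] s_fix[OF assms(1)] by (auto simp: adds_vertex_orbit_def)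

lemma zero_extension_delete:
  assumes "free_edges s V E" "v \<in> V" "v \<noteq> r" "nbrs E v = {a, b}" "a \<noteq> b"
  shows "allowable_extension s \<lparr>verts = V - {v, s v}, edges = induced E (V - {v, s v})\<rparr>
           \<lparr>verts = V, edges = E\<rparr>"
proof -
  define F where "F = induced E (V - {v, s v})"
  have ab: "{a, b} \<subseteq> V - {v, s v}" using nbrs_in_delete[OF assms(1,2)] assms(4) by simp
  have star: "{{v, a}, {v, b}, s ` {v, a}, s ` {v, b}} =
      (\<lambda>w. {v, w}) ` nbrs E v \<union> (\<lambda>w. s ` {v, w}) ` nbrs E v"
    unfolding assms(4) by auto
  have eq: "E = F \<union> {{v, a}, {v, b}, s ` {v, a}, s ` {v, b}}"
    unfolding star F_def by (rule edges_split[OF assms(1,2), unfolded Un_assoc])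
  have pair: "symmetric_pair s \<lparr>verts = V - {v, s v}, edges = F\<rparr> \<lparr>verts = V, edges = E\<rparr>"
    unfolding F_def using half_turn_delete[OF assms(2,3)]
    by (intro symmetric_pairI[OF _ half_turn_axioms] free_edges_induced[OF assms(1)] assms(1)) auto
  have "zero_extension s \<lparr>verts = V - {v, s v}, edges = F\<rparr> \<lparr>verts = V, edges = E\<rparr>"
    unfolding zero_extension_def
    unfolding ugraph.select_convs
    by (rule conjI[OF pair], rule exI[of _ v], rule exI[of _ a], rule exI[of _ b])
      (intro conjI adds_vertex_orbit_delete[OF assms(2,3)] ab assms(5) eq)
  then show ?thesis unfolding allowable_extension_def F_def by blast
qed

text \<open>
  The new edge of the smaller graph joins \<open>a\<close> either to \<open>b\<close> or to \<open>s b\<close>. The first choice undoes a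
  1-extension and the second a modified one, except that both choices give the same edge orbit if \<open>a\<close>
  or \<open>b\<close> is the fixed vertex.
\<close>

lemma one_extension_delete:
  assumes "free_edges s V E" "v \<in> V" "v \<noteq> r" "nbrs E v = {a, b, c}" "distinct [a, b, c]"
    "b \<noteq> s a" "b' = b \<or> b' = s b" "{a, b'} \<notin> E"
  shows "allowable_extension s
           \<lparr>verts = V - {v, s v}, edges = induced E (V - {v, s v}) \<union> edge_orbit s a b'\<rparr>
           \<lparr>verts = V, edges = E\<rparr>"
proof -
  let ?V = "V - {v, s v}"
  define F where "F = induced E ?V"
  let ?H = "\<lparr>verts = ?V, edges = F \<union> edge_orbit s a b'\<rparr>"
  let ?G = "\<lparr>verts = V, edges = E\<rparr>"
  have abc: "{a, b, c} \<subseteq> ?V" using nbrs_in_delete[OF assms(1,2)] assms(4) by simp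
  interpret V': half_turn s r ?V by (rule half_turn_delete[OF assms(2,3)])
  have in_V: "a \<in> V" "b \<in> V" "a \<in> ?V" "b \<in> ?V" using abc by auto
  have b'_in: "b' \<in> ?V" "b' \<in> V" using assms(7) in_V(4) V'.s_in[of b] by auto
  have ne: "b' \<noteq> a" "b' \<noteq> s a"
    using assms(5,6,7) in_V s_swap[of a b] s_eq_iff[of a b] by auto
  have notin: "edge_orbit s a b' \<inter> E = {}"
    by (rule orbit_notin[OF assms(1) in_V(1) b'_in(2) assms(8)])
  have star: "{{v, a}, {v, b}, {v, c}, s ` {v, a}, s ` {v, b}, s ` {v, c}} =
      (\<lambda>w. {v, w}) ` nbrs E v \<union> (\<lambda>w. s ` {v, w}) ` nbrs E v"
    unfolding assms(4) by auto
  have "F \<subseteq> E" by (auto simp: F_def induced_def)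
  then have F: "F \<union> edge_orbit s a b' - edge_orbit s a b' = F" using notin by blast
  have eq: "E = (F \<union> edge_orbit s a b' - edge_orbit s a b') \<union>
      {{v, a}, {v, b}, {v, c}, s ` {v, a}, s ` {v, b}, s ` {v, c}}"
    unfolding F star unfolding F_def by (rule edges_split[OF assms(1,2), unfolded Un_assoc])
  have free: "free_edges s ?V (F \<union> edge_orbit s a b')"
    unfolding F_def using ne in_V b'_in half_turn_delete(2)[OF assms(2,3)]
    by (intro V'.free_edges_Un V'.free_edges_orbit free_edges_induced[OF assms(1)]) auto
  have pair: "symmetric_pair s ?H ?G"
    by (rule symmetric_pairI[OF V'.half_turn_axioms half_turn_axioms free assms(1)])
  have orbit: "edge_orbit s a b' = {{a, b'}, s ` {a, b'}}" by (simp add: edge_orbit_def)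
  note vert = adds_vertex_orbit_delete[OF assms(2,3), of "F \<union> edge_orbit s a b'" E]
  show ?thesis
  proof (cases "b' = b \<or> a = r \<or> b = r")
    case True
    have orb: "edge_orbit s a b' = {{a, b}, s ` {a, b}}"
      using True assms(7) s_root s_s[OF in_V(2)] unfolding edge_orbit_def by auto
    then have mem: "{a, b} \<in> F \<union> edge_orbit s a b'" by simp
    have ne': "{a, b} \<noteq> s ` {a, b}" using free_edgesD(4)[OF free mem] by (rule not_sym)
    have eq': "E = (F \<union> edge_orbit s a b' - {{a, b}, s ` {a, b}}) \<union>
        {{v, a}, {v, b}, {v, c}, s ` {v, a}, s ` {v, b}, s ` {v, c}}"
      unfolding orb[symmetric] by (rule eq)
    have "one_extension s ?H ?G"
      unfolding one_extension_def ugraph.select_convs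
      by (rule conjI[OF pair], rule exI[of _ v], rule exI[of _ a], rule exI[of _ b],
          rule exI[of _ c], rule exI[of _ "{a, b}"])
        (intro conjI vert abc assms(5) refl mem ne' eq')
    then show ?thesis unfolding allowable_extension_def F_def by blast
  next
    case False
    then have b': "b' = s b" using assms(7) by blast
    have "a \<noteq> s a" "b \<noteq> s b" using False s_fix in_V(1,2) by metis+
    moreover have "a \<noteq> s b" "s a \<noteq> s b" using assms(5,6) s_swap s_eq_iff in_V(1,2) by auto
    ultimately have dist: "distinct [a, b, s a, s b]" using assms(5,6) by simp
    have mem: "{a, s b} \<in> F \<union> edge_orbit s a b'" unfolding b' by (simp add: edge_orbit_def)
    have eq': "E = (F \<union> edge_orbit s a b' - {{a, s b}, s ` {a, s b}}) \<union>
        {{v, a}, {v, b}, {v, c}, s ` {v, a}, s ` {v, b}, s ` {v, c}}"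
      unfolding orbit[unfolded b', symmetric] using eq unfolding b' .
    have "modified_one_extension s ?H ?G"
      unfolding modified_one_extension_def ugraph.select_convs
      by (rule conjI[OF pair], rule exI[of _ v], rule exI[of _ a], rule exI[of _ b],
          rule exI[of _ c], rule exI[of _ "{a, s b}"])
        (intro conjI vert abc assms(5) refl mem dist eq')
    then show ?thesis unfolding allowable_extension_def F_def by blast
  qed
qed

end

section \<open>Vertices of degree at most three\<close>

context tree_pair
begin

lemma free1: "free_edges s V E\<^sub>1" and conn1: "inv_connects s E\<^sub>1 r V"
  and free2: "free_edges s V E\<^sub>2" and conn2: "inv_connects s E\<^sub>2 r V"
  using tree1 tree2 unfolding sym_tree_def by auto

lemma free: "free_edges s V (E\<^sub>1 \<union> E\<^sub>2)"
  by (rule free_edges_Un[OF free1 free2])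

lemma card_union: "card (E\<^sub>1 \<union> E\<^sub>2) + 2 = 2 * card V"
proof -
  have "card (E\<^sub>1 \<union> E\<^sub>2) = card E\<^sub>1 + card E\<^sub>2"
    using finite_free_edges[OF free1] finite_free_edges[OF free2] disjoint
    by (rule card_Un_disjoint)
  then show ?thesis using tree1 tree2 unfolding sym_tree_def by simp
qed

lemma nbrs_disjoint: "nbrs E\<^sub>1 v \<inter> nbrs E\<^sub>2 v = {}"
  using disjoint by (auto simp: nbrs_def)

lemma tree_pair_delete:
  assumes "v \<in> V" "v \<noteq> r" "free_edges s (V - {v, s v}) F\<^sub>1" "free_edges s (V - {v, s v}) F\<^sub>2"
    "inv_connects s F\<^sub>1 r (V - {v, s v})" "inv_connects s F\<^sub>2 r (V - {v, s v})" "F\<^sub>1 \<inter> F\<^sub>2 = {}"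
    "card (F\<^sub>1 \<union> F\<^sub>2) + 4 = card (E\<^sub>1 \<union> E\<^sub>2)"
  shows "tree_pair s r (V - {v, s v}) F\<^sub>1 F\<^sub>2"
proof (rule tree_pairI)
  show "half_turn s r (V - {v, s v})" by (rule half_turn_delete(1)[OF assms(1,2)])
  show "card (F\<^sub>1 \<union> F\<^sub>2) + 2 = 2 * card (V - {v, s v})"
    using assms(8) card_union card_delete[OF assms(1,2)] by linarith
qed fact+

lemma reducible_delete:
  assumes "v \<in> V" "tree_pair s r (V - {v, s v}) F\<^sub>1 F\<^sub>2"
    "{x, y} \<subseteq> V - {v, s v}" "x \<noteq> y"
    "allowable_extension s \<lparr>verts = V - {v, s v}, edges = F\<^sub>1 \<union> F\<^sub>2\<rparr> \<lparr>verts = V, edges = E\<^sub>1 \<union> E\<^sub>2\<rparr>"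
  shows "reducible s r V (E\<^sub>1 \<union> E\<^sub>2)"
proof -
  have "V - {v, s v} \<subset> V" using assms(1) by blast
  moreover have "V - {v, s v} \<noteq> {r}"
  proof
    assume "V - {v, s v} = {r}"
    then show False using assms(3,4) by simp
  qed
  ultimately show ?thesis
    unfolding reducible_def using assms(2,5)
    by (intro exI[of _ "V - {v, s v}"] exI[of _ F\<^sub>1] exI[of _ F\<^sub>2] conjI)
qed

lemma reducible_by_zero_extension:
  assumes "v \<in> V" "v \<noteq> r" "nbrs E\<^sub>1 v = {a}" "nbrs E\<^sub>2 v = {b}"
  shows "reducible s r V (E\<^sub>1 \<union> E\<^sub>2)"
proof -
  let ?V = "V - {v, s v}"
  have ab: "nbrs (E\<^sub>1 \<union> E\<^sub>2) v = {a, b}" "a \<noteq> b"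
    using nbrs_disjoint[of v] assms(3,4) by (auto simp: nbrs_Un)
  note inv = half_turn_delete(2)[OF assms(1,2)]
  have "inv_connects s (induced E\<^sub>1 ?V) r ?V"
    by (rule inv_connects_delete[OF free1 conn1 assms(1,2)]) (simp add: assms(3))
  moreover have "inv_connects s (induced E\<^sub>2 ?V) r ?V"
    by (rule inv_connects_delete[OF free2 conn2 assms(1,2)]) (simp add: assms(4))
  moreover have "card (induced E\<^sub>1 ?V \<union> induced E\<^sub>2 ?V) + 4 = card (E\<^sub>1 \<union> E\<^sub>2)"
    using card_edges_delete[OF free assms(1,2)] ab by (simp add: induced_Un)
  moreover have "induced E\<^sub>1 ?V \<inter> induced E\<^sub>2 ?V = {}"
    using disjoint induced_subset by blast
  ultimately have "tree_pair s r ?V (induced E\<^sub>1 ?V) (induced E\<^sub>2 ?V)"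
    using free_edges_induced[OF free1 inv] free_edges_induced[OF free2 inv]
    by (intro tree_pair_delete[OF assms(1,2)])
  then show ?thesis
    using nbrs_in_delete[OF free assms(1)] ab zero_extension_delete[OF free assms(1,2) ab]
    by (intro reducible_delete[OF assms(1), of _ _ a b]) (simp_all add: induced_Un)
qed

lemma reducible_by_one_extension:
  assumes "v \<in> V" "v \<noteq> r" "nbrs (E\<^sub>1 \<union> E\<^sub>2) v = {x, y, z}" "distinct [x, y, z]"
    "y \<noteq> s x" "y' = y \<or> y' = s y" "{x, y'} \<notin> E\<^sub>1 \<union> E\<^sub>2"
    and F: "F\<^sub>1 \<union> F\<^sub>2 = induced (E\<^sub>1 \<union> E\<^sub>2) (V - {v, s v}) \<union> edge_orbit s x y'" "F\<^sub>1 \<inter> F\<^sub>2 = {}"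
    "free_edges s (V - {v, s v}) F\<^sub>1" "free_edges s (V - {v, s v}) F\<^sub>2"
    "inv_connects s F\<^sub>1 r (V - {v, s v})" "inv_connects s F\<^sub>2 r (V - {v, s v})"
  shows "reducible s r V (E\<^sub>1 \<union> E\<^sub>2)"
proof -
  let ?V = "V - {v, s v}"
  have xyz: "{x, y, z} \<subseteq> ?V" using nbrs_in_delete[OF free assms(1)] assms(3) by simp
  have V: "x \<in> V" "y \<in> V" "y' \<in> V" using xyz assms(6) s_in by auto
  have ne: "x \<noteq> y'" "y' \<noteq> s x"
    using assms(4,5,6) V s_swap[of x y] s_eq_iff[of x y] by auto
  have "edge_orbit s x y' \<inter> (E\<^sub>1 \<union> E\<^sub>2) = {}"
    by (rule orbit_notin[OF free V(1,3) assms(7)])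
  then have "induced (E\<^sub>1 \<union> E\<^sub>2) ?V \<inter> edge_orbit s x y' = {}"
    using induced_subset[of "E\<^sub>1 \<union> E\<^sub>2" ?V] by blast
  moreover have "finite (induced (E\<^sub>1 \<union> E\<^sub>2) ?V)"
    using finite_free_edges[OF free] induced_subset by (rule finite_subset[rotated])
  moreover have "finite (edge_orbit s x y')" by (simp add: edge_orbit_def)
  ultimately have "card (F\<^sub>1 \<union> F\<^sub>2) = card (induced (E\<^sub>1 \<union> E\<^sub>2) ?V) + 2"
    using card_orbit[OF V(1,3) ne] unfolding F(1) by (simp add: card_Un_disjoint)
  moreover have "card (nbrs (E\<^sub>1 \<union> E\<^sub>2) v) = 3" using assms(3,4) by simp
  ultimately have "card (F\<^sub>1 \<union> F\<^sub>2) + 4 = card (E\<^sub>1 \<union> E\<^sub>2)"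
    using card_edges_delete[OF free assms(1,2)] by linarith
  then have "tree_pair s r ?V F\<^sub>1 F\<^sub>2"
    using F by (intro tree_pair_delete[OF assms(1,2)])
  moreover have "{x, y} \<subseteq> ?V" "x \<noteq> y" using xyz assms(4) by auto
  ultimately show ?thesis
    using one_extension_delete[OF free assms(1-7)] unfolding F(1)[symmetric]
    by (rule reducible_delete[OF assms(1)])
qed

text \<open>
  The first tree loses the leaf \<open>v\<close>. The second tree is mended by the orbit of \<open>{x, y'}\<close>, and the last
  premise expresses that this orbit connects the two parts into which it fell.
\<close>

lemma reducible_by_join:
  assumes "v \<in> V" "v \<noteq> r" "nbrs E\<^sub>1 v = {a}" "nbrs E\<^sub>2 v = {b, c}" "{x, y, z} = {a, b, c}"
    "distinct [x, y, z]" "y \<noteq> s x" "y' = y \<or> y' = s y" "{x, y'} \<notin> E\<^sub>1 \<union> E\<^sub>2"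
    and key: "\<And>S. \<lbrakk>S \<subseteq> V - {v, s v}; r \<in> S; s ` S \<subseteq> S;
        closed_under (induced E\<^sub>2 (V - {v, s v})) S; x \<in> S \<longleftrightarrow> y \<in> S\<rbrakk> \<Longrightarrow> b \<in> S \<longleftrightarrow> c \<in> S"
  shows "reducible s r V (E\<^sub>1 \<union> E\<^sub>2)"
proof (rule reducible_by_one_extension[OF assms(1,2) _ assms(6,7,8,9)])
  let ?V = "V - {v, s v}"
  interpret V': half_turn s r ?V by (rule half_turn_delete(1)[OF assms(1,2)])
  note inv = half_turn_delete(2)[OF assms(1,2)]
  show nb: "nbrs (E\<^sub>1 \<union> E\<^sub>2) v = {x, y, z}"
    unfolding nbrs_Un assms(3,4) assms(5) by auto
  have xy: "x \<in> ?V" "y \<in> ?V" using nbrs_in_delete[OF free assms(1)] nb by auto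
  then have V: "x \<in> V" "y \<in> V" "y' \<in> V" "y' \<in> ?V" using assms(8) V'.s_in[of y] by auto
  have ne: "x \<noteq> y'" "y' \<noteq> s x"
    using assms(6,7,8) V s_swap[of x y] s_eq_iff[of x y] by auto
  have notin: "edge_orbit s x y' \<inter> (E\<^sub>1 \<union> E\<^sub>2) = {}"
    by (rule orbit_notin[OF free V(1,3) assms(9)])
  show "induced E\<^sub>1 ?V \<union> (induced E\<^sub>2 ?V \<union> edge_orbit s x y') =
      induced (E\<^sub>1 \<union> E\<^sub>2) ?V \<union> edge_orbit s x y'"
    by (simp add: induced_Un Un_assoc)
  show "induced E\<^sub>1 ?V \<inter> (induced E\<^sub>2 ?V \<union> edge_orbit s x y') = {}"
    using notin disjoint induced_subset[of E\<^sub>1 ?V] induced_subset[of E\<^sub>2 ?V] by blast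
  show "free_edges s ?V (induced E\<^sub>1 ?V)" by (rule free_edges_induced[OF free1 inv])
  show "free_edges s ?V (induced E\<^sub>2 ?V \<union> edge_orbit s x y')"
    using V'.free_edges_orbit[OF xy(1) V(4) ne]
    by (intro V'.free_edges_Un free_edges_induced[OF free2 inv])
  show "inv_connects s (induced E\<^sub>1 ?V) r ?V"
    by (rule inv_connects_delete[OF free1 conn1 assms(1,2)]) (simp add: assms(3))
  show "inv_connects s (induced E\<^sub>2 ?V \<union> edge_orbit s x y') r ?V"
  proof (rule inv_connects_delete[OF free2 conn2 assms(1,2)])
    fix S assume S: "S \<subseteq> ?V" "r \<in> S" "s ` S \<subseteq> S"
      "closed_under (induced E\<^sub>2 ?V \<union> edge_orbit s x y') S"
    have ind: "closed_under (induced E\<^sub>2 ?V) S" and orb: "closed_under (edge_orbit s x y') S"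
      using S(4) by (auto simp: closed_under_Un)
    have "x \<in> S \<longleftrightarrow> y' \<in> S" by (rule closed_under_iff[OF orb]) (simp add: edge_orbit_def)
    also have "\<dots> \<longleftrightarrow> y \<in> S" using assms(8) V'.inv_iff[OF S(1,3) xy(2)] by blast
    finally have "b \<in> S \<longleftrightarrow> c \<in> S" using key[OF S(1-3) ind] by blast
    then show "closed_under (induced E\<^sub>2 ?V) S \<and> (nbrs E\<^sub>2 v \<subseteq> S \<or> nbrs E\<^sub>2 v \<inter> S = {})"
      using ind unfolding assms(4) by blast
  qed
qed

text \<open>
  Deleting the orbit of \<open>v\<close> leaves the tree \<open>E\<^sub>2\<close> with two parts in the quotient, that of \<open>r\<close> and that of
  \<open>b\<close>: an edge between \<open>b\<close> and \<open>r\<close> would reconnect it, and \<open>P \<union> Q\<close> is closed under that edge as well.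
\<close>

lemma parts_cover:
  assumes "v \<in> V" "v \<noteq> r" "nbrs E\<^sub>2 v = {b, r}"
    and P: "P \<subseteq> V - {v, s v}" "s ` P \<subseteq> P" "closed_under (induced E\<^sub>2 (V - {v, s v})) P" "r \<in> P"
    and Q: "Q \<subseteq> V - {v, s v}" "s ` Q \<subseteq> Q" "closed_under (induced E\<^sub>2 (V - {v, s v})) Q" "b \<in> Q"
  shows "P \<union> Q = V - {v, s v}"
proof -
  have "inv_connects s (edge_orbit s b r \<union> induced E\<^sub>2 (V - {v, s v})) r (V - {v, s v})"
  proof (rule inv_connects_delete[OF free2 conn2 assms(1,2)])
    fix S assume "r \<in> S" "closed_under (edge_orbit s b r \<union> induced E\<^sub>2 (V - {v, s v})) S"
    then have "closed_under (induced E\<^sub>2 (V - {v, s v})) S" "closed_under (edge_orbit s b r) S"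
      by (simp_all add: closed_under_Un)
    moreover have "{r, b} \<in> edge_orbit s b r" by (simp add: edge_orbit_def insert_commute)
    ultimately have "closed_under (induced E\<^sub>2 (V - {v, s v})) S" "b \<in> S"
      using \<open>r \<in> S\<close> closed_underD[of "edge_orbit s b r" S r b] by simp_all
    then show "closed_under (induced E\<^sub>2 (V - {v, s v})) S \<and>
        (nbrs E\<^sub>2 v \<subseteq> S \<or> nbrs E\<^sub>2 v \<inter> S = {})"
      using \<open>r \<in> S\<close> assms(3) by simp
  qed
  then show ?thesis
  proof (rule inv_connectsD)
    show sub: "P \<union> Q \<subseteq> V - {v, s v}" and r_in: "r \<in> P \<union> Q" and inv: "s ` (P \<union> Q) \<subseteq> P \<union> Q"
      using P(1,2,4) Q(1,2) by blast+
    have "closed_under (induced E\<^sub>2 (V - {v, s v})) (P \<union> Q)"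
      using P(3) Q(3) unfolding closed_under_def by blast
    moreover have "closed_under (edge_orbit s b r) (P \<union> Q)"
    proof (rule closed_under_orbit)
      show "P \<union> Q \<subseteq> V" "s ` (P \<union> Q) \<subseteq> P \<union> Q" "r \<in> V" using sub inv root by auto
      show "b \<in> V" using Q(1,4) by blast
      show "b \<in> P \<union> Q \<longleftrightarrow> r \<in> P \<union> Q" using r_in Q(4) by blast
    qed
    ultimately show "closed_under (edge_orbit s b r \<union> induced E\<^sub>2 (V - {v, s v})) (P \<union> Q)"
      by (simp add: closed_under_Un)
  qed
qed

text \<open>
  The edge from \<open>b\<close> to \<open>r\<close>, which would mend the second tree, is already used by the first one. Let \<open>P\<close>
  be the part of \<open>r\<close> in the broken second tree, so that \<open>b\<close> is in the other part.

  If \<open>a\<close> lies in \<open>P\<close>, an edge from \<open>a\<close> to \<open>b\<close> or \<open>s b\<close> mends it. Only the first tree could contain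
  these edges, since the second one would have \<open>b\<close> in \<open>P\<close>, and the first contains at most one.

  If \<open>a\<close> lies in the part of \<open>b\<close>, the edge from \<open>a\<close> to \<open>r\<close> mends it, unless it is present already. In that
  case the first tree contains the path \<open>a, r, b\<close>, and the edge from \<open>r\<close> to \<open>b\<close> is handed over to the
  second tree. In the first tree it is replaced by an edge from \<open>a\<close> to \<open>b\<close> or \<open>s b\<close>, at most one of which
  is present, since only the second tree can contain them without creating a triangle.
\<close>

lemma reducible_if_root_neighbour:
  assumes "v \<in> V" "v \<noteq> r" "nbrs E\<^sub>1 v = {a}" "nbrs E\<^sub>2 v = {b, r}" "b \<noteq> r" "a \<noteq> s b"
    "{r, b} \<in> E\<^sub>1"
  shows "reducible s r V (E\<^sub>1 \<union> E\<^sub>2)"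
proof -
  let ?V = "V - {v, s v}"
  interpret V': half_turn s r ?V by (rule half_turn_delete(1)[OF assms(1,2)])
  note inv = half_turn_delete(2)[OF assms(1,2)]
  have va: "{v, a} \<in> E\<^sub>1" and vb: "{v, b} \<in> E\<^sub>2" and vr: "{v, r} \<in> E\<^sub>2"
    using assms(3,4) by (auto simp: nbrs_def)
  have "a \<noteq> b" "a \<noteq> r" using va vb vr disjoint by auto
  have in_V: "a \<in> ?V" "b \<in> ?V" "r \<in> ?V"
    using nbrs_in_delete[OF free1 assms(1)] nbrs_in_delete[OF free2 assms(1)] assms(3,4) by auto
  then have "b \<noteq> s a" using assms(6) s_swap[of a b] by auto
  have free_gain: "\<exists>b'. (b' = b \<or> b' = s b) \<and> {a, b'} \<notin> E\<^sub>1 \<union> E\<^sub>2"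
    if "T = E\<^sub>1 \<or> T = E\<^sub>2" "{a, b} \<notin> T" "{a, s b} \<notin> T" for T
    using that no_parallel[OF tree1 \<open>a \<noteq> r\<close> assms(5)] no_parallel[OF tree2 \<open>a \<noteq> r\<close> assms(5)]
    by auto
  obtain B where B: "B \<subseteq> V" "r \<in> B" "s ` B \<subseteq> B" "closed_under (E\<^sub>2 - edge_orbit s v b) B"
    "(v \<in> B) \<noteq> (b \<in> B)" by (rule bridge[OF tree2 vb])
  define P where "P = B \<inter> ?V"
  have "v \<noteq> s v" using s_fix[OF assms(1)] assms(2) by metis
  then have "{v, r} \<notin> edge_orbit s v b"
    using assms(5) free_edges_nbr(5)[OF free2 vb] by (simp add: edge_orbit_def doubleton_eq_iff)
  then have "v \<in> B \<longleftrightarrow> r \<in> B" using vr by (intro closed_under_iff[OF B(4)]) simp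
  then have "b \<notin> P" using B(2,5) by (auto simp: P_def)
  have P: "P \<subseteq> ?V" "s ` P \<subseteq> P" "r \<in> P"
    using B(2,3) inv in_V by (auto simp: P_def)
  have P_closed: "closed_under (induced E\<^sub>2 ?V) P"
    unfolding closed_under_def
  proof (intro ballI allI impI)
    fix x y assume x: "x \<in> P" and "{x, y} \<in> induced E\<^sub>2 ?V"
    then have e: "{x, y} \<in> E\<^sub>2" "x \<in> ?V" "y \<in> ?V" by (simp_all add: induced_edge_iff)
    then have "{x, y} \<notin> edge_orbit s v b" by (auto simp: edge_orbit_def doubleton_eq_iff)
    then have "y \<in> B" using x e by (intro closed_underD[OF B(4), of x y]) (auto simp: P_def)
    then show "y \<in> P" using e by (simp add: P_def)
  qed
  have complement: "closed_under (induced E\<^sub>2 ?V) (?V - S)" "s ` (?V - S) \<subseteq> ?V - S"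
    if "S \<subseteq> ?V" "s ` S \<subseteq> S" "closed_under (induced E\<^sub>2 ?V) S" for S
  proof -
    show "closed_under (induced E\<^sub>2 ?V) (?V - S)"
      unfolding closed_under_def
    proof (intro ballI allI impI)
      fix x y assume x: "x \<in> ?V - S" and e: "{x, y} \<in> induced E\<^sub>2 ?V"
      have "y \<in> ?V" using e by (simp add: induced_edge_iff)
      then show "y \<in> ?V - S" using x closed_under_iff[OF that(3) e] by blast
    qed
    show "s ` (?V - S) \<subseteq> ?V - S"
    proof
      fix y assume "y \<in> s ` (?V - S)"
      then obtain x where x: "x \<in> ?V" "x \<notin> S" "y = s x" by blast
      then show "y \<in> ?V - S" using V'.s_in[OF x(1)] V'.inv_iff[OF that(1,2) x(1)] by simp
    qed
  qed
  show ?thesis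
  proof (cases "a \<in> P")
    case True
    have "{a, b'} \<notin> E\<^sub>2" if "b' = b \<or> b' = s b" for b'
    proof
      assume "{a, b'} \<in> E\<^sub>2"
      then have "{a, b'} \<in> induced E\<^sub>2 ?V"
        using in_V inv that by (auto simp: induced_edge_iff)
      then have "b' \<in> P" using True by (rule closed_underD[OF P_closed])
      then show False using \<open>b \<notin> P\<close> that V'.inv_iff[OF P(1,2) in_V(2)] by blast
    qed
    then obtain b' where b': "b' = b \<or> b' = s b" "{a, b'} \<notin> E\<^sub>1 \<union> E\<^sub>2"
      using free_gain[of E\<^sub>2] by blast
    show ?thesis
    proof (rule reducible_by_join[OF assms(1-4), of a b r b'])
      fix S assume S: "S \<subseteq> ?V" "r \<in> S" "s ` S \<subseteq> S" "closed_under (induced E\<^sub>2 ?V) S" "a \<in> S \<longleftrightarrow> b \<in> S"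
      \<comment> \<open>The part of \<open>b\<close> is disjoint from \<open>P\<close>, so
        \<open>S\<close> has to contain \<open>P\<close> and with it \<open>a\<close>.\<close>
      have "S \<union> (?V - P) = ?V"
        using S \<open>b \<notin> P\<close> in_V complement[OF P(1,2) P_closed]
        by (intro parts_cover[OF assms(1,2,4)]) auto
      then have "a \<in> S" using True in_V by blast
      then show "b \<in> S \<longleftrightarrow> r \<in> S" using S by blast
    qed (use assms(5) \<open>a \<noteq> b\<close> \<open>a \<noteq> r\<close> \<open>b \<noteq> s a\<close> b' in auto)
  next
    case False
    show ?thesis
    proof (cases "{a, r} \<in> E\<^sub>1 \<union> E\<^sub>2")
      case no: False
      show ?thesis
      proof (rule reducible_by_join[OF assms(1-4), of a r b r])
        fix S assume S: "S \<subseteq> ?V" "r \<in> S" "s ` S \<subseteq> S" "closed_under (induced E\<^sub>2 ?V) S" "a \<in> S \<longleftrightarrow> r \<in> S"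
        show "b \<in> S \<longleftrightarrow> r \<in> S"
        proof (rule ccontr)
          assume "\<not> (b \<in> S \<longleftrightarrow> r \<in> S)"
          \<comment> \<open>If \<open>S\<close> missed \<open>b\<close>, its complement would
            contain the part of \<open>b\<close> and with it \<open>a\<close>.\<close>
          then have "P \<union> (?V - S) = ?V"
            using S P P_closed in_V complement[OF S(1,3,4)]
            by (intro parts_cover[OF assms(1,2,4)]) auto
          then show False using False S(2,5) in_V by blast
        qed
      qed (use assms(5) \<open>a \<noteq> b\<close> \<open>a \<noteq> r\<close> no s_root_iff in_V in auto)
    next
      case True
      have "{r, a} \<notin> induced E\<^sub>2 ?V"
        using False P(3) by (auto dest: closed_underD[OF P_closed])
      then have ra: "{r, a} \<in> E\<^sub>1" using True in_V by (auto simp: induced_edge_iff insert_commute)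
      have "{a, b} \<notin> E\<^sub>1" "{a, s b} \<notin> E\<^sub>1"
        using no_triangle[OF tree1 ra assms(7) \<open>a \<noteq> b\<close>] by auto
      then obtain b' where b': "b' = b \<or> b' = s b" "{a, b'} \<notin> E\<^sub>1 \<union> E\<^sub>2"
        using free_gain[of E\<^sub>1] by blast
      have b'_in: "b' \<in> ?V" using b'(1) in_V(2) V'.s_in by auto
      have ne: "a \<noteq> b'" "b' \<noteq> s a"
        using b'(1) \<open>a \<noteq> b\<close> \<open>b \<noteq> s a\<close> assms(6) s_eq_iff[of a b] in_V by auto
      let ?O = "edge_orbit s r b" let ?N = "edge_orbit s a b'"
      have N: "?N \<inter> (E\<^sub>1 \<union> E\<^sub>2) = {}"
        using in_V b'_in b'(2) by (intro orbit_notin[OF free]) auto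
      have O: "?O \<subseteq> E\<^sub>1" by (rule orbit_subset[OF free1 assms(7)])
      have O': "?O \<subseteq> induced E\<^sub>1 ?V"
        using in_V assms(7) by (intro V'.orbit_subset[OF free_edges_induced[OF free1 inv]])
          (simp add: induced_edge_iff)
      show ?thesis
      proof (rule reducible_by_one_extension[OF assms(1,2), of a b r b'
            "induced E\<^sub>1 ?V - ?O \<union> ?N" "induced E\<^sub>2 ?V \<union> ?O"])
        show "nbrs (E\<^sub>1 \<union> E\<^sub>2) v = {a, b, r}" by (auto simp: nbrs_Un assms(3,4))
        show "induced E\<^sub>1 ?V - ?O \<union> ?N \<union> (induced E\<^sub>2 ?V \<union> ?O) = induced (E\<^sub>1 \<union> E\<^sub>2) ?V \<union> ?N"
          using O' by (auto simp: induced_Un)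
        show "(induced E\<^sub>1 ?V - ?O \<union> ?N) \<inter> (induced E\<^sub>2 ?V \<union> ?O) = {}"
          using N O disjoint induced_subset[of E\<^sub>1 ?V] induced_subset[of E\<^sub>2 ?V] by blast
        show "free_edges s ?V (induced E\<^sub>1 ?V - ?O \<union> ?N)"
          by (intro V'.free_edges_Un V'.free_edges_Diff_orbit V'.free_edges_orbit
              free_edges_induced[OF free1 inv] in_V b'_in ne)
        show "free_edges s ?V (induced E\<^sub>2 ?V \<union> ?O)"
          using assms(5) s_root
          by (intro V'.free_edges_Un V'.free_edges_orbit free_edges_induced[OF free2 inv] in_V) auto
        show "inv_connects s (induced E\<^sub>1 ?V - ?O \<union> ?N) r ?V"
        proof (rule inv_connects_delete[OF free1 conn1 assms(1,2)])
          fix S assume S: "S \<subseteq> ?V" "r \<in> S" "s ` S \<subseteq> S" "closed_under (induced E\<^sub>1 ?V - ?O \<union> ?N) S"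
          have cl: "closed_under (induced E\<^sub>1 ?V - ?O) S" "closed_under ?N S"
            using S(4) by (auto simp: closed_under_Un)
          have "{r, a} \<notin> ?O"
            using \<open>a \<noteq> b\<close> assms(6) s_root by (auto simp: edge_orbit_def doubleton_eq_iff)
          then have "a \<in> S" using S(2) ra in_V
            by (intro closed_underD[OF cl(1), of r a]) (auto simp: induced_edge_iff)
          then have "b' \<in> S"
            by (intro closed_underD[OF cl(2), of a b']) (auto simp: edge_orbit_def)
          then have "b \<in> S" using b'(1) V'.inv_iff[OF S(1,3) in_V(2)] by blast
          then have "closed_under ?O S"
            using S(1-3) in_V by (intro V'.closed_under_orbit) auto
          then have "closed_under (induced E\<^sub>1 ?V - ?O \<union> ?O) S"
            using cl(1) by (simp only: closed_under_Un)
          moreover have "induced E\<^sub>1 ?V - ?O \<union> ?O = induced E\<^sub>1 ?V" using O' by blast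
          ultimately show "closed_under (induced E\<^sub>1 ?V) S \<and> (nbrs E\<^sub>1 v \<subseteq> S \<or> nbrs E\<^sub>1 v \<inter> S = {})"
            using assms(3) by auto
        qed
        show "inv_connects s (induced E\<^sub>2 ?V \<union> ?O) r ?V"
        proof (rule inv_connects_delete[OF free2 conn2 assms(1,2)])
          fix S assume S: "r \<in> S" "closed_under (induced E\<^sub>2 ?V \<union> ?O) S"
          then have "b \<in> S" by (intro closed_underD[OF S(2), of r b]) (auto simp: edge_orbit_def)
          then show "closed_under (induced E\<^sub>2 ?V) S \<and> (nbrs E\<^sub>2 v \<subseteq> S \<or> nbrs E\<^sub>2 v \<inter> S = {})"
            using S assms(4) by (auto simp: closed_under_Un)
        qed
      qed (use assms(5) \<open>a \<noteq> b\<close> \<open>a \<noteq> r\<close> \<open>b \<noteq> s a\<close> b' in auto)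
    qed
  qed
qed

text \<open>
  The second tree is mended by an edge from \<open>b\<close> to \<open>c\<close> or \<open>s c\<close> if one of them is missing. If both are
  present, they lie in the first tree by \<open>no_triangle\<close>, and by \<open>no_parallel\<close> this is
  possible only if \<open>b\<close> or \<open>c\<close> is the fixed vertex.
\<close>

lemma reducible_or_wheel_of_degrees:
  assumes "v \<in> V" "v \<noteq> r" "nbrs E\<^sub>1 v = {a}" "nbrs E\<^sub>2 v = {b, c}" "b \<noteq> c"
  shows "reducible s r V (E\<^sub>1 \<union> E\<^sub>2) \<or>
    (\<exists>d. d \<noteq> r \<and> nbrs (E\<^sub>1 \<union> E\<^sub>2) v = {d, s d, r} \<and> {r, d} \<in> E\<^sub>1 \<union> E\<^sub>2)"
proof -
  have va: "{v, a} \<in> E\<^sub>1" and vb: "{v, b} \<in> E\<^sub>2" and vc: "{v, c} \<in> E\<^sub>2"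
    using assms(3,4) by (auto simp: nbrs_def)
  have abc: "a \<noteq> b" "a \<noteq> c" using va vb vc disjoint by auto
  have V: "a \<in> V" "b \<in> V" "c \<in> V"
    using free_edges_nbr(2)[OF free1 va] free_edges_nbr(2)[OF free2 vb]
      free_edges_nbr(2)[OF free2 vc] by auto
  have "c \<noteq> s b"
  proof
    assume c: "c = s b"
    then have "b \<noteq> r" using assms(5) s_root by auto
    then show False using no_parallel[OF tree2 assms(2) _ vb] vc c by blast
  qed
  show ?thesis
  proof (cases "\<exists>c'. (c' = c \<or> c' = s c) \<and> {b, c'} \<notin> E\<^sub>1 \<union> E\<^sub>2")
    case True
    then obtain c' where c': "c' = c \<or> c' = s c" "{b, c'} \<notin> E\<^sub>1 \<union> E\<^sub>2" by blast
    have "reducible s r V (E\<^sub>1 \<union> E\<^sub>2)"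
      by (rule reducible_by_join[OF assms(1-4), of b c a c'])
        (use assms(5) abc \<open>c \<noteq> s b\<close> c' in auto)
    then show ?thesis by blast
  next
    case False
    moreover have "{b, c} \<notin> E\<^sub>2" "{b, s c} \<notin> E\<^sub>2"
      using no_triangle[OF tree2 vb vc assms(5)] by auto
    ultimately have bc: "{b, c} \<in> E\<^sub>1" "{b, s c} \<in> E\<^sub>1" by auto
    have main: ?thesis if "nbrs E\<^sub>2 v = {d, r}" "{r, d} \<in> E\<^sub>1" "d \<noteq> r" for d
    proof (cases "a = s d")
      case True
      then show ?thesis using that assms(3)
        by (intro disjI2 exI[of _ d]) (auto simp: nbrs_Un)
    next
      case False
      then show ?thesis
        using reducible_if_root_neighbour[OF assms(1-3) that(1,3) _ that(2)] by blast
    qed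
    have "b = r \<or> c = r"
      using no_parallel[OF tree1 _ _ bc(1)] bc(2) by blast
    then show ?thesis
    proof
      assume "b = r"
      then show ?thesis using main[of c] assms(4,5) bc(1) by (auto simp: insert_commute)
    next
      assume "c = r"
      then show ?thesis using main[of b] assms(4,5) bc(1) by (auto simp: insert_commute)
    qed
  qed
qed

lemma reducible_or_wheel:
  assumes "v \<in> V" "v \<noteq> r" "card (nbrs (E\<^sub>1 \<union> E\<^sub>2) v) \<le> 3"
  shows "reducible s r V (E\<^sub>1 \<union> E\<^sub>2) \<or>
    card (nbrs (E\<^sub>1 \<union> E\<^sub>2) v) = 3 \<and>
    (\<exists>d. d \<noteq> r \<and> nbrs (E\<^sub>1 \<union> E\<^sub>2) v = {d, s d, r} \<and> {r, d} \<in> E\<^sub>1 \<union> E\<^sub>2)"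
proof -
  have fin: "finite (nbrs E\<^sub>1 v)" "finite (nbrs E\<^sub>2 v)"
    using finite_nbrs free1 free2 by auto
  have card: "card (nbrs (E\<^sub>1 \<union> E\<^sub>2) v) = card (nbrs E\<^sub>1 v) + card (nbrs E\<^sub>2 v)"
    unfolding nbrs_Un by (rule card_Un_disjoint[OF fin nbrs_disjoint])
  have "card (nbrs E\<^sub>1 v) \<noteq> 0" "card (nbrs E\<^sub>2 v) \<noteq> 0"
    using nbrs_nonempty[OF free1 conn1 assms(1,2)] nbrs_nonempty[OF free2 conn2 assms(1,2)] fin
    by auto
  then consider "card (nbrs E\<^sub>1 v) = 1" "card (nbrs E\<^sub>2 v) = 1"
    | "card (nbrs E\<^sub>1 v) = 1" "card (nbrs E\<^sub>2 v) = 2"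
    | "card (nbrs E\<^sub>1 v) = 2" "card (nbrs E\<^sub>2 v) = 1"
    using card assms(3) by linarith
  then show ?thesis
  proof cases
    case 1
    then show ?thesis
      using reducible_by_zero_extension[OF assms(1,2)] by (metis card_1_singletonE)
  next
    case 2
    then obtain a b c where "nbrs E\<^sub>1 v = {a}" "nbrs E\<^sub>2 v = {b, c}" "b \<noteq> c"
      by (metis card_1_singletonE card_2_iff)
    then show ?thesis
      using reducible_or_wheel_of_degrees[OF assms(1,2)] card 2 by simp
  next
    case 3
    then obtain a b c where *: "nbrs E\<^sub>2 v = {a}" "nbrs E\<^sub>1 v = {b, c}" "b \<noteq> c"
      by (metis card_1_singletonE card_2_iff)
    interpret swap: tree_pair s r V E\<^sub>2 E\<^sub>1 by (rule tree_pair_swap) (rule tree_pair_axioms)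
    show ?thesis
      using swap.reducible_or_wheel_of_degrees[OF assms(1,2) *] card 3
      unfolding Un_commute[of E\<^sub>2 E\<^sub>1] by simp
  qed
qed

end

section \<open>The wheel at the fixed vertex\<close>

lemma card_edges_wheel5:
  assumes "distinct [v0, v1, v2, v3, v4]"
  shows "card (edges (wheel5 v0 v1 v2 v3 v4)) = 8"
proof -
  have "distinct [{v1, v2}, {v2, v3}, {v3, v4}, {v4, v1}, {v0, v1}, {v0, v2}, {v0, v3}, {v0, v4}]"
    using assms by (auto simp: doubleton_eq_iff)
  from distinct_card[OF this] show ?thesis by (simp add: wheel5_def)
qed

context tree_pair
begin

lemma root_nbrs_nonempty:
  assumes "V \<noteq> {r}"
  shows "nbrs (E\<^sub>1 \<union> E\<^sub>2) r \<noteq> {}"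
proof
  assume "nbrs (E\<^sub>1 \<union> E\<^sub>2) r = {}"
  then have "closed_under E\<^sub>1 {r}" by (auto simp: closed_under_def nbrs_def)
  then have "{r} = V" using root s_root by (intro inv_connectsD[OF conn1]) auto
  then show False using assms by simp
qed

text \<open>
  By the degree sum, the numbers \<open>4 - deg v\<close> add up to \<open>deg r\<close> over the vertices other than \<open>r\<close>. Only the
  vertices of degree three contribute positively, by one each, and all of them are neighbours of \<open>r\<close>.
  So every neighbour of \<open>r\<close> has degree three.
\<close>

lemma exists_cubic_triangle:
  assumes "V \<noteq> {r}" "\<not> reducible s r V (E\<^sub>1 \<union> E\<^sub>2)"
  shows "\<exists>v d. v \<in> V \<and> v \<noteq> r \<and> d \<noteq> r \<and> nbrs (E\<^sub>1 \<union> E\<^sub>2) v = {d, s d, r} \<and>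
    {r, d} \<in> E\<^sub>1 \<union> E\<^sub>2 \<and> card (nbrs (E\<^sub>1 \<union> E\<^sub>2) d) = 3"
proof -
  let ?deg = "\<lambda>v. card (nbrs (E\<^sub>1 \<union> E\<^sub>2) v)"
  let ?A = "V - {r}"
  define W where "W = {v \<in> ?A. ?deg v \<le> 3}"
  have fin: "finite ?A" "finite W" using finite_V by (auto simp: W_def)
  have W: "?deg v = 3 \<and> (\<exists>d. d \<noteq> r \<and> nbrs (E\<^sub>1 \<union> E\<^sub>2) v = {d, s d, r} \<and> {r, d} \<in> E\<^sub>1 \<union> E\<^sub>2)"
    if "v \<in> W" for v
    using that reducible_or_wheel[of v] assms(2) unfolding W_def by blast
  have W_sub: "W \<subseteq> nbrs (E\<^sub>1 \<union> E\<^sub>2) r"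
  proof
    fix v assume "v \<in> W"
    then have "r \<in> nbrs (E\<^sub>1 \<union> E\<^sub>2) v" using W[of v] by auto
    then show "v \<in> nbrs (E\<^sub>1 \<union> E\<^sub>2) r" by (simp add: nbrs_def insert_commute)
  qed
  have "4 * card ?A = (\<Sum>v\<in>?A. 4)" by simp
  also have "\<dots> \<le> (\<Sum>v\<in>?A. ?deg v + (if v \<in> W then 1 else 0))"
  proof (rule sum_mono)
    fix v assume v: "v \<in> ?A"
    show "4 \<le> ?deg v + (if v \<in> W then 1 else 0)"
    proof (cases "v \<in> W")
      case True
      then show ?thesis using W[OF True] by simp
    next
      case False
      then have "\<not> ?deg v \<le> 3" using v unfolding W_def by simp
      then show ?thesis by simp
    qed
  qed
  also have "\<dots> = (\<Sum>v\<in>?A. ?deg v) + card (?A \<inter> W)"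
    using fin(1) by (simp add: sum.distrib sum.If_cases)
  also have "?A \<inter> W = W" by (auto simp: W_def)
  finally have "4 * card ?A \<le> (\<Sum>v\<in>?A. ?deg v) + card W" .
  moreover have "(\<Sum>v\<in>V. ?deg v) = ?deg r + (\<Sum>v\<in>?A. ?deg v)"
    by (rule sum.remove[OF finite_V root])
  moreover have "card V = card ?A + 1" using card.remove[OF finite_V root] by simp
  ultimately have "?deg r \<le> card W"
    using degree_sum[OF free] card_union by linarith
  then have W_eq: "W = nbrs (E\<^sub>1 \<union> E\<^sub>2) r"
    by (intro card_seteq finite_nbrs[OF free] W_sub)
  then obtain v where v: "v \<in> W" using root_nbrs_nonempty[OF assms(1)] by blast
  obtain d where d: "d \<noteq> r" "nbrs (E\<^sub>1 \<union> E\<^sub>2) v = {d, s d, r}" "{r, d} \<in> E\<^sub>1 \<union> E\<^sub>2"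
    using W[OF v] by blast
  have "d \<in> W" unfolding W_eq using d(3) by (simp add: nbrs_def)
  then have "?deg d = 3" using W[of d] by blast
  moreover have "v \<in> V" "v \<noteq> r" using v by (auto simp: W_def)
  ultimately show ?thesis using d by blast
qed

text \<open>
  The neighbours of \<open>v\<close>, \<open>d\<close>, \<open>s v\<close> and \<open>s d\<close> are all among these vertices and \<open>r\<close>, so that the wheel on
  the five vertices is attached to the rest at \<open>r\<close> only. No edge outside the wheel changes when it is shrunk, so the map \<open>\<pi>\<close> of
  the extension is constant with value \<open>r\<close>.
\<close>

lemma wheel_or_reducible_if_cubic_triangle:
  assumes "v \<in> V" "v \<noteq> r" "d \<noteq> r" "nbrs (E\<^sub>1 \<union> E\<^sub>2) v = {d, s d, r}"
    "{r, d} \<in> E\<^sub>1 \<union> E\<^sub>2" "card (nbrs (E\<^sub>1 \<union> E\<^sub>2) d) = 3"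
  shows "is_wheel5 \<lparr>verts = V, edges = E\<^sub>1 \<union> E\<^sub>2\<rparr> \<or> reducible s r V (E\<^sub>1 \<union> E\<^sub>2)"
proof -
  define E where "E = E\<^sub>1 \<union> E\<^sub>2"
  define X where "X = {v, d, s v, s d}"
  define U where "U = V - X"
  let ?W = "wheel5 r v d (s v) (s d)"
  note fr = free[folded E_def]
  have vd: "{v, d} \<in> E" and vsd: "{v, s d} \<in> E" and vr: "{v, r} \<in> E"
    using assms(4) by (auto simp: nbrs_def E_def)
  note nb = free_edges_nbr[OF fr vd]
  have dv: "d \<in> V" "d \<noteq> v" "d \<noteq> s v" "v \<noteq> s d" using nb by auto
  have fixs: "s v \<noteq> v" "s d \<noteq> d" "s v \<noteq> r" "s d \<noteq> r" "s v \<noteq> s d"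
    using s_fix s_root_iff s_eq_iff assms(1-3) dv by auto
  have dist: "distinct [r, v, d, s v, s d]" using dv fixs assms(2,3) by auto
  have svd: "{s v, d} \<in> E" using vsd edge_s_swap[OF fr assms(1) dv(1)] by simp
  have "{v, s v, r} \<subseteq> nbrs E d"
    using vd svd assms(5) by (simp add: nbrs_def insert_commute E_def)
  moreover have "card {v, s v, r} = 3" using fixs assms(2) by auto
  ultimately have nbrs_d: "nbrs E d = {v, s v, r}"
    using assms(6) by (metis E_def card_seteq finite_nbrs fr order_refl)
  have nbrs_v: "nbrs E v = {d, s d, r}" using assms(4) by (simp add: E_def)
  have nbrs_sv: "nbrs E (s v) = {s d, d, r}"
    using nbrs_s[OF fr assms(1)] nbrs_v s_s[OF dv(1)] s_root by simp
  have nbrs_sd: "nbrs E (s d) = {s v, v, r}"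
    using nbrs_s[OF fr dv(1)] nbrs_d s_s[OF assms(1)] s_root by simp
  have nbrs_X: "nbrs E x \<subseteq> insert r X" if "x \<in> X" for x
    using that nbrs_v nbrs_d nbrs_sv nbrs_sd unfolding X_def by auto
  have W_sub: "edges ?W \<subseteq> E"
  proof -
    have "w \<in> nbrs E x \<Longrightarrow> {x, w} \<in> E" for x w by (simp add: nbrs_def)
    then have "{d, s v} \<in> E" "{s v, s d} \<in> E" "{s d, v} \<in> E" "{s v, r} \<in> E" "{s d, r} \<in> E"
      by (simp_all add: nbrs_d nbrs_sv nbrs_sd)
    then show ?thesis
      using vd vr assms(5)[folded E_def] by (simp add: wheel5_def insert_commute)
  qed
  have E_eq: "E = edges ?W \<union> induced E U"
  proof
    show "edges ?W \<union> induced E U \<subseteq> E" using W_sub induced_subset[of E U] by blast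
    show "E \<subseteq> edges ?W \<union> induced E U"
    proof
      fix e assume e: "e \<in> E"
      obtain x y where xy: "e = {x, y}" by (rule free_edges_cases[OF fr e])
      have *: "{a, b} \<in> edges ?W" if ab: "a \<in> X" "b \<in> nbrs E a" for a b
      proof -
        have edge_W: "b \<in> N \<Longrightarrow> \<forall>w\<in>N. {a, w} \<in> edges ?W \<Longrightarrow> ?thesis" for N by blast
        consider "a = v" | "a = d" | "a = s v" | "a = s d" using ab(1) unfolding X_def by blast
        then show ?thesis
        proof cases
          case 1 show ?thesis
            using ab(2)[unfolded 1 nbrs_v] by (rule edge_W) (simp add: 1 wheel5_def insert_commute)
        next
          case 2 show ?thesis
            using ab(2)[unfolded 2 nbrs_d] by (rule edge_W) (simp add: 2 wheel5_def insert_commute)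
        next
          case 3 show ?thesis
            using ab(2)[unfolded 3 nbrs_sv] by (rule edge_W) (simp add: 3 wheel5_def insert_commute)
        next
          case 4 show ?thesis
            using ab(2)[unfolded 4 nbrs_sd] by (rule edge_W) (simp add: 4 wheel5_def insert_commute)
        qed
      qed
      consider "x \<in> X" | "y \<in> X" | "x \<in> U" "y \<in> U"
        using free_edges_nbr(1,2)[OF fr, of x y] e xy unfolding U_def by blast
      then show "e \<in> edges ?W \<union> induced E U"
      proof cases
        case 1 then show ?thesis using *[of x y] e xy by (simp add: nbrs_def)
      next
        case 2 then show ?thesis using *[of y x] e xy by (simp add: nbrs_def insert_commute)
      next
        case 3 then show ?thesis using e xy by (simp add: induced_edge_iff)
      qed
    qed
  qed
  have X_sub: "X \<subseteq> V" using assms(1) dv s_in by (simp add: X_def)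
  have rU: "r \<in> U" using root dist by (auto simp: U_def X_def)
  have sX: "s ` X \<subseteq> X" using s_s assms(1) dv by (auto simp: X_def)
  have sU: "s ` U \<subseteq> U"
  proof
    fix y assume "y \<in> s ` U"
    then obtain x where x: "x \<in> V" "x \<notin> X" "y = s x" by (auto simp: U_def)
    then show "y \<in> U" using s_in[OF x(1)] inv_iff[OF X_sub sX x(1)] by (simp add: U_def)
  qed
  have ht: "half_turn s r U"
    using rU sU by (intro half_turn_subset) (auto simp: U_def)
  show ?thesis
  proof (cases "U = {r}")
    case True
    then have "induced E U = {}"
      using free_edges_not_subset_singleton[OF fr] by (simp add: induced_def)
    then have "edges ?W \<union> induced E U = edges ?W" by simp
    with E_eq have "E = edges ?W" by (rule trans)
    moreover have "V = verts ?W" using True X_sub root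
      by (auto simp: U_def X_def wheel5_def)
    ultimately have "\<lparr>verts = V, edges = E\<rparr> = ?W" by simp
    then show ?thesis using dist unfolding is_wheel5_def E_def by blast
  next
    case False
    let ?F\<^sub>1 = "induced E\<^sub>1 U" and ?F\<^sub>2 = "induced E\<^sub>2 U"
    have F: "?F\<^sub>1 \<union> ?F\<^sub>2 = induced E U" by (simp add: E_def induced_Un)
    have conn: "inv_connects s (induced T U) r U" if "T \<subseteq> E" "inv_connects s T r V" for T
      unfolding inv_connects_def
    proof (intro allI impI)
      fix S assume S: "S \<subseteq> U" "r \<in> S" "s ` S \<subseteq> S" "closed_under (induced T U) S"
      have "closed_under T (S \<union> X)"
        unfolding closed_under_def
      proof (intro ballI allI impI)
        fix x y assume x: "x \<in> S \<union> X" and e: "{x, y} \<in> T"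
        have eE: "{x, y} \<in> E" using e that(1) by blast
        show "y \<in> S \<union> X"
        proof (cases "x \<in> X")
          case True
          then show ?thesis using nbrs_X[OF True] eE S(2) by (auto simp: nbrs_def)
        next
          case False
          then have xS: "x \<in> S" using x by blast
          show ?thesis
          proof (cases "y \<in> X")
            case False
            then have "{x, y} \<in> induced T U"
              using e xS S(1) free_edges_nbr(2)[OF fr eE] by (auto simp: induced_edge_iff U_def)
            then have "y \<in> S" using xS by (rule closed_underD[OF S(4)])
            then show ?thesis by blast
          qed blast
        qed
      qed
      moreover have "S \<union> X \<subseteq> V" using S(1) X_sub by (auto simp: U_def)
      moreover have "s ` (S \<union> X) \<subseteq> S \<union> X" using S(3) sX by (auto simp: image_Un)
      ultimately have "S \<union> X = V" using S(2) by (intro inv_connectsD[OF that(2)]) auto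
      then show "S = U" using S(1) by (auto simp: U_def)
    qed
    have "card (edges ?W) = 8" by (rule card_edges_wheel5[OF dist])
    moreover have "edges ?W \<inter> induced E U = {}"
      using dist by (auto simp: wheel5_def induced_def U_def X_def)
    moreover have "finite (edges ?W)" "finite (induced E U)"
      using finite_free_edges[OF fr] W_sub induced_subset[of E U] by (auto intro: finite_subset)
    ultimately have "card E = 8 + card (induced E U)"
      using E_eq card_Un_disjoint by metis
    moreover have "card V = card U + 4"
    proof -
      have "card X = 4" using dist by (simp add: X_def)
      moreover have "finite X" by (simp add: X_def)
      ultimately show ?thesis
        using card_Diff_subset[OF _ X_sub] card_mono[OF finite_V X_sub] by (simp add: U_def)
    qed
    ultimately have "card (?F\<^sub>1 \<union> ?F\<^sub>2) + 2 = 2 * card U"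
      unfolding F using card_union unfolding E_def by linarith
    moreover have "?F\<^sub>1 \<inter> ?F\<^sub>2 = {}" using disjoint induced_subset by blast
    moreover have "inv_connects s ?F\<^sub>1 r U" "inv_connects s ?F\<^sub>2 r U"
      using conn conn1 conn2 by (auto simp: E_def)
    ultimately have "tree_pair s r U ?F\<^sub>1 ?F\<^sub>2"
      by (intro tree_pairI[OF ht] free_edges_induced[OF free1 sU] free_edges_induced[OF free2 sU])
    moreover have "U \<subset> V" using assms(1) by (auto simp: U_def X_def)
    moreover have "fixed_vertex_to_W5_extension s \<lparr>verts = U, edges = induced E U\<rparr> \<lparr>verts = V, edges = E\<rparr>"
    proof -
      let ?H = "\<lparr>verts = U, edges = induced E U\<rparr>" and ?G = "\<lparr>verts = V, edges = E\<rparr>"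
      have pair: "symmetric_pair s ?H ?G"
        by (rule symmetric_pairI[OF ht half_turn_axioms free_edges_induced[OF fr sU] fr])
      have "subgraph_of ?W ?G"
        using W_sub X_sub root by (auto simp: subgraph_of_def wheel5_def X_def)
      moreover have "acts_as_theta_star s r v d (s v) (s d)"
        using s_root s_s assms(1) dv by (simp add: acts_as_theta_star_def)
      moreover have "V = U \<union> verts ?W" "U \<inter> verts ?W = {r}"
        using X_sub root rU by (auto simp: U_def X_def wheel5_def)
      moreover have "(\<lambda>w. r) \<in> neighbours ?H r \<rightarrow> verts ?W" by (simp add: wheel5_def)
      moreover have "edges ?W \<union> (induced E U - {{w, r} |w. {w, r} \<in> induced E U}) \<union>
          {{w, r} |w. w \<in> neighbours ?H r} = E"
      proof -
        let ?N = "{{w, r} |w. {w, r} \<in> induced E U}"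
        have N: "{{w, r} |w. w \<in> neighbours ?H r} = ?N"
          by (auto simp: neighbours_def induced_edge_iff)
        have "edges ?W \<union> (induced E U - ?N) \<union> ?N = edges ?W \<union> induced E U" by blast
        then show ?thesis unfolding N using E_eq[symmetric] by (rule trans)
      qed
      ultimately show ?thesis
        unfolding fixed_vertex_to_W5_extension_def using pair dist s_root
        by (intro conjI exI[of _ r] exI[of _ v] exI[of _ d] exI[of _ "s v"] exI[of _ "s d"]
            exI[of _ ?W] exI[of _ "\<lambda>w. r"]) simp_all
    qed
    then have "allowable_extension s \<lparr>verts = U, edges = ?F\<^sub>1 \<union> ?F\<^sub>2\<rparr> \<lparr>verts = V, edges = E\<^sub>1 \<union> E\<^sub>2\<rparr>"
      unfolding F allowable_extension_def by (simp add: E_def)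
    ultimately show ?thesis
      using False unfolding reducible_def by (intro disjI2 exI conjI)
  qed
qed

lemma is_wheel5_or_reducible:
  assumes "V \<noteq> {r}"
  shows "is_wheel5 \<lparr>verts = V, edges = E\<^sub>1 \<union> E\<^sub>2\<rparr> \<or> reducible s r V (E\<^sub>1 \<union> E\<^sub>2)"
proof (rule disjCI)
  assume "\<not> reducible s r V (E\<^sub>1 \<union> E\<^sub>2)"
  from exists_cubic_triangle[OF assms this] this
  show "is_wheel5 \<lparr>verts = V, edges = E\<^sub>1 \<union> E\<^sub>2\<rparr>"
    by (elim exE conjE) (meson wheel_or_reducible_if_cubic_triangle)
qed

end

section \<open>Passing between graphs and pairs of trees\<close>

lemma (in half_turn) spanning_tree_of_sym_tree:
  assumes "sym_tree s r V E" "E \<subseteq> F"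
  shows "spanning_tree \<lparr>verts = V, edges = E\<rparr> \<lparr>verts = V, edges = F\<rparr>"
proof -
  have free: "free_edges s V E" using assms(1) by (simp add: sym_tree_def)
  have "is_tree \<lparr>verts = V, edges = E\<rparr>"
    using is_tree_iff_card[of "\<lparr>verts = V, edges = E\<rparr>" r] simple_graph_of[OF free]
      inv_connects_imp_connects[OF free] assms(1) finite_V root
    by (simp add: sym_tree_def)
  then show ?thesis using assms(2) by (simp add: spanning_tree_def subgraph_of_def)
qed

lemma (in tree_pair) two_symmetric_spanning_trees:
  assumes "V \<noteq> {r}"
  shows "two_symmetric_spanning_trees s \<lparr>verts = V, edges = E\<^sub>1 \<union> E\<^sub>2\<rparr>"
    and "no_fixed_edge s \<lparr>verts = V, edges = E\<^sub>1 \<union> E\<^sub>2\<rparr>"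
proof -
  have "E\<^sub>1 \<noteq> E\<^sub>2"
  proof
    assume "E\<^sub>1 = E\<^sub>2"
    then have "E\<^sub>1 = {}" using disjoint by simp
    then have "card V = 1" using tree1 by (simp add: sym_tree_def)
    then show False using assms root by (metis card_1_singletonE singletonD)
  qed
  then show "two_symmetric_spanning_trees s \<lparr>verts = V, edges = E\<^sub>1 \<union> E\<^sub>2\<rparr>"
    unfolding two_symmetric_spanning_trees_def
    using spanning_tree_of_sym_tree[OF tree1, of "E\<^sub>1 \<union> E\<^sub>2"]
      spanning_tree_of_sym_tree[OF tree2, of "E\<^sub>1 \<union> E\<^sub>2"]
      z2_symmetric_of[OF free1] z2_symmetric_of[OF free2] disjoint
    by (intro exI[of _ "\<lparr>verts = V, edges = E\<^sub>1\<rparr>"] exI[of _ "\<lparr>verts = V, edges = E\<^sub>2\<rparr>"]) simp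
  show "no_fixed_edge s \<lparr>verts = V, edges = E\<^sub>1 \<union> E\<^sub>2\<rparr>"
    unfolding no_fixed_edge_def using free_edgesD(4)[OF free] by simp
qed

lemma construction_chain:
  assumes "tree_pair s r V E\<^sub>1 E\<^sub>2" "V \<noteq> {r}"
  shows "\<exists>(n::nat) C. n \<ge> 1 \<and> is_wheel5 (C 1) \<and> C n = \<lparr>verts = V, edges = E\<^sub>1 \<union> E\<^sub>2\<rparr> \<and>
    (\<forall>k\<in>{1..<n}. allowable_extension s (C k) (C (k + 1)) \<and>
       two_symmetric_spanning_trees s (C k) \<and> no_fixed_edge s (C k))"
  using assms
proof (induction "card V" arbitrary: V E\<^sub>1 E\<^sub>2 rule: less_induct)
  case less
  interpret tree_pair s r V E\<^sub>1 E\<^sub>2 by fact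
  let ?G = "\<lparr>verts = V, edges = E\<^sub>1 \<union> E\<^sub>2\<rparr>"
  consider "is_wheel5 ?G" | "reducible s r V (E\<^sub>1 \<union> E\<^sub>2)"
    using is_wheel5_or_reducible[OF less.prems(2)] by blast
  then show ?case
  proof cases
    case 1
    then show ?thesis by (intro exI[of _ 1] exI[of _ "\<lambda>_. ?G"]) simp
  next
    case 2
    then obtain V' F\<^sub>1 F\<^sub>2 where F: "tree_pair s r V' F\<^sub>1 F\<^sub>2" "V' \<subset> V" "V' \<noteq> {r}"
      "allowable_extension s \<lparr>verts = V', edges = F\<^sub>1 \<union> F\<^sub>2\<rparr> ?G"
      unfolding reducible_def by blast
    have "card V' < card V" by (rule psubset_card_mono[OF finite_V F(2)])
    then obtain n :: nat and C where C: "n \<ge> 1" "is_wheel5 (C 1)"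
      "C n = \<lparr>verts = V', edges = F\<^sub>1 \<union> F\<^sub>2\<rparr>"
      "\<forall>k\<in>{1..<n}. allowable_extension s (C k) (C (k + 1)) \<and>
         two_symmetric_spanning_trees s (C k) \<and> no_fixed_edge s (C k)"
      using less.hyps[OF _ F(1,3)] by blast
    note H = tree_pair.two_symmetric_spanning_trees[OF F(1,3)]
    let ?C = "C(Suc n := ?G)"
    have "allowable_extension s (?C k) (?C (k + 1)) \<and>
        two_symmetric_spanning_trees s (?C k) \<and> no_fixed_edge s (?C k)" if "k \<in> {1..<Suc n}" for k
    proof (cases "k = n")
      case True
      then show ?thesis using F(4) C(3) H by simp
    next
      case False
      then show ?thesis using C(4) that by simp
    qed
    then show ?thesis using C(1,2) by (intro exI[of _ "Suc n"] exI[of _ ?C]) simp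
  qed
qed

text \<open>
  Every step of the growth from \<open>r\<close> adds an orbit of vertices and at least two edges, namely the edge
  leading there and its image. A fixed vertex adds one vertex but still two edges. For a tree, with
  \<open>card V = card E + 1\<close>, the bound leaves room for a single fixed vertex.
\<close>

lemma fixed_points_card:
  assumes "finite V" "\<And>x. x \<in> V \<Longrightarrow> s x \<in> V \<and> s (s x) = x" "r \<in> V" "s r = r"
    "free_edges s V E" "connects E r V"
  shows "card V + card {x \<in> V. s x = x} \<le> card E + 2"
proof -
  have fin: "finite E"
    by (rule finite_subset[of _ "Pow V"]) (use assms(1) free_edgesD(1)[OF assms(5)] in auto)
  let ?P = "\<lambda>S. s ` S \<subseteq> S \<and> card S + card {x \<in> S. s x = x} \<le> card {e \<in> E. e \<subseteq> S} + 2"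
  have sub: "\<forall>e\<in>E. e \<subseteq> V" using free_edgesD(1)[OF assms(5)] by simp
  have "?P V"
  proof (rule connects_grow[OF assms(1,3,6) sub])
    have "{x \<in> {r}. s x = x} = {r}" using assms(4) by auto
    then show "?P {r}" using assms(4) by simp
  next
    fix S x y
    assume S: "S \<subseteq> V" "?P S" "x \<in> S" "y \<in> V - S" "{x, y} \<in> E"
    let ?T = "insert y (insert (s y) S)"
    have y: "y \<in> V" "y \<notin> S" "s y \<in> V" "s (s y) = y" using S(4) assms(2)[of y] by auto
    have sy: "s y \<notin> S" using S(2) y by (metis image_subset_iff)
    have finS: "finite S" using S(1) assms(1) by (rule finite_subset)
    have sx: "s x \<in> S" using S(2,3) by blast
    have inv: "s ` ?T \<subseteq> ?T" using S(2) y by auto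
    have "{s x, s y} \<in> E" "{s x, s y} \<noteq> {x, y}"
      using free_edgesD(3,4)[OF assms(5) S(5)] by simp_all
    then have "insert {x, y} (insert {s x, s y} {e \<in> E. e \<subseteq> S}) \<subseteq> {e \<in> E. e \<subseteq> ?T}"
      using S(3,5) sx by auto
    then have "card (insert {x, y} (insert {s x, s y} {e \<in> E. e \<subseteq> S})) \<le> card {e \<in> E. e \<subseteq> ?T}"
      using fin by (intro card_mono) auto
    moreover have "card (insert {x, y} (insert {s x, s y} {e \<in> E. e \<subseteq> S})) = card {e \<in> E. e \<subseteq> S} + 2"
      using fin y sy \<open>{s x, s y} \<noteq> {x, y}\<close> by simp
    moreover have "card ?T + card {x \<in> ?T. s x = x} \<le> card S + card {x \<in> S. s x = x} + 2"
    proof (cases "s y = y")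
      case True
      then have "{x \<in> ?T. s x = x} = insert y {x \<in> S. s x = x}" by auto
      then show ?thesis using True finS y by simp
    next
      case False
      then have "{x \<in> ?T. s x = x} = {x \<in> S. s x = x}" using y(4) by auto
      then show ?thesis using False finS y sy by simp
    qed
    ultimately have "?P ?T" using S(2) inv by linarith
    then show "\<exists>S'. S \<subset> S' \<and> S' \<subseteq> V \<and> ?P S'"
      using S(1) y by (intro exI[of _ ?T]) auto
  qed
  moreover have "{e \<in> E. e \<subseteq> V} = E" using sub by blast
  ultimately show ?thesis by simp
qed

text \<open>
  The edges of the tree are paired by \<open>s\<close>, so the number of vertices is odd and some vertex is fixed.
  By the count of fixed vertices there is no second one.
\<close>

lemma exists_half_turn:
  assumes "finite V" "\<And>x. x \<in> V \<Longrightarrow> s x \<in> V \<and> s (s x) = x" "free_edges s V E"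
    "is_tree \<lparr>verts = V, edges = E\<rparr>"
  shows "\<exists>r. half_turn s r V"
proof -
  let ?T = "\<lparr>verts = V, edges = E\<rparr>"
  have card: "card V = card E + 1" using tree_card_edges[OF _ assms(4)] assms(1) by simp
  have simple: "simple_graph ?T" using assms(4) by (simp add: is_tree_def)
  have "even (card E)"
  proof (rule even_card_involution)
    show "finite E" using finite_edges[OF _ simple] assms(1) by simp
    fix e assume e: "e \<in> E"
    have "s ` s ` e = e"
      using free_edgesD(1)[OF assms(3) e] assms(2) by (force simp: image_image)
    then show "s ` e \<in> E \<and> s ` s ` e = e \<and> s ` e \<noteq> e"
      using free_edgesD(3,4)[OF assms(3) e] by simp
  qed
  then have "odd (card V)" using card by simp
  then obtain r where r: "r \<in> V" "s r = r"
    using even_card_involution[OF assms(1), of s] assms(2) by blast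
  have "connects E r V"
    using is_tree_iff_card[of ?T r] assms(1,4) simple r(1) by simp
  then have "card V + card {x \<in> V. s x = x} \<le> card E + 2"
    using assms(1-3) r by (intro fixed_points_card) auto
  then have "card {x \<in> V. s x = x} \<le> Suc 0" using card by simp
  then have "x = r" if "x \<in> V" "s x = x" for x
    using that r assms(1) card_le_Suc0_iff_eq[of "{x \<in> V. s x = x}"] by auto
  then have "s x = x \<longleftrightarrow> x = r" if "x \<in> V" for x
    using that r(2) by blast
  then have "half_turn s r V"
    using assms(1,2) r(1) by (simp add: half_turn_def)
  then show ?thesis ..
qed

lemma z2_action_involution:
  assumes "z2_action \<theta> G" "x \<in> verts G"
  shows "\<theta> 1 x \<in> verts G" "\<theta> 1 (\<theta> 1 x) = x"
proof -
  have hom: "\<theta> \<in> hom (integer_mod_group 2) (aut_group G)"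
    using assms(1) by (simp add: z2_action_def)
  have carrier: "0 \<in> carrier (integer_mod_group 2)" "1 \<in> carrier (integer_mod_group 2)"
    by (simp_all add: carrier_integer_mod_group)
  have bij: "\<theta> i \<in> Bij (verts G)" if "i \<in> carrier (integer_mod_group 2)" for i
    using hom_in_carrier[OF hom that] by (auto simp: aut_group_def graph_auts_def)
  have mult: "\<theta> ((i + j) mod 2) y = \<theta> i (\<theta> j y)"
    if "i \<in> carrier (integer_mod_group 2)" "j \<in> carrier (integer_mod_group 2)" "y \<in> verts G" for i j y
    using hom_mult[OF hom that(1,2)] bij[OF that(1)] bij[OF that(2)] that(3)
    by (simp add: aut_group_def BijGroup_def compose_eq)
  have maps: "\<theta> i \<in> verts G \<rightarrow> verts G" if "i \<in> carrier (integer_mod_group 2)" for i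
    using bij[OF that] by (rule Bij_imp_funcset)
  show "\<theta> 1 x \<in> verts G" using maps[OF carrier(2)] assms(2) by blast
  have "inj_on (\<theta> 0) (verts G)"
    using bij[OF carrier(1)] by (simp add: Bij_def bij_betw_def)
  moreover have "\<theta> 0 (\<theta> 0 x) = \<theta> 0 x" using mult[OF carrier(1,1) assms(2)] by simp
  moreover have "\<theta> 0 x \<in> verts G" using maps[OF carrier(1)] assms(2) by blast
  ultimately have "\<theta> 0 x = x" using assms(2) by (simp add: inj_on_eq_iff)
  then show "\<theta> 1 (\<theta> 1 x) = x" using mult[OF carrier(2,2) assms(2)] by simp
qed

lemma free_edges_of_symmetric:
  assumes "simple_graph T" "z2_symmetric s T" "no_fixed_edge s G" "edges T \<subseteq> edges G"
  shows "free_edges s (verts T) (edges T)"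
  unfolding free_edges_def
proof
  fix e assume e: "e \<in> edges T"
  then have *: "e \<subseteq> verts T" "card e = 2" using assms(1) by (auto simp: simple_graph_def)
  obtain x y where xy: "e = {x, y}" using *(2) by (meson card_2_iff)
  then have V: "x \<in> verts T" "y \<in> verts T" using *(1) by auto
  have "{restrict s (verts T) x, restrict s (verts T) y} \<in> edges T"
    using assms(2) V e xy unfolding z2_symmetric_def graph_auts_def by blast
  then have "s ` e \<in> edges T" using V xy by simp
  moreover have "s ` e \<noteq> e" using assms(3,4) e by (auto simp: no_fixed_edge_def)
  ultimately show "e \<subseteq> verts T \<and> card e = 2 \<and> s ` e \<in> edges T \<and> s ` e \<noteq> e" using * by blast
qed

theorem theorem2p17:
  fixes G :: "'v ugraph" and \<theta> :: "int \<Rightarrow> 'v \<Rightarrow> 'v"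
  assumes "finite (verts G)" and "simple_graph G"
    and "z2_action \<theta> G"
    and "two_symmetric_spanning_trees (\<theta> 1) G"
    and "no_fixed_edge (\<theta> 1) G"
  shows "\<exists>(n::nat) (C :: nat \<Rightarrow> 'v ugraph).
           n \<ge> 1 \<and> is_wheel5 (C 1) \<and> C n = G \<and>
           (\<forall>k\<in>{1..<n}.
              allowable_extension (\<theta> 1) (C k) (C (k + 1)) \<and>
              two_symmetric_spanning_trees (\<theta> 1) (C k) \<and>
              no_fixed_edge (\<theta> 1) (C k))"
proof -
  let ?s = "\<theta> 1" and ?V = "verts G"
  obtain T\<^sub>1 T\<^sub>2 where T: "T\<^sub>1 \<noteq> T\<^sub>2" "spanning_tree T\<^sub>1 G" "spanning_tree T\<^sub>2 G"
    "edges T\<^sub>1 \<inter> edges T\<^sub>2 = {}" "edges G = edges T\<^sub>1 \<union> edges T\<^sub>2"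
    "z2_symmetric ?s T\<^sub>1" "z2_symmetric ?s T\<^sub>2"
    using assms(4) unfolding two_symmetric_spanning_trees_def by blast
  have tree: "is_tree T\<^sub>1" "is_tree T\<^sub>2" and verts: "verts T\<^sub>1 = ?V" "verts T\<^sub>2 = ?V"
    using T(2,3) by (auto simp: spanning_tree_def)
  then have simple: "simple_graph T\<^sub>1" "simple_graph T\<^sub>2" by (auto simp: is_tree_def)
  have free: "free_edges ?s ?V (edges T\<^sub>1)" "free_edges ?s ?V (edges T\<^sub>2)"
    using free_edges_of_symmetric[OF simple(1) T(6) assms(5)]
      free_edges_of_symmetric[OF simple(2) T(7) assms(5)] verts T(5) by auto
  have "T\<^sub>1 = \<lparr>verts = ?V, edges = edges T\<^sub>1\<rparr>" using verts(1) by simp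
  then obtain r where "half_turn ?s r ?V"
    using exists_half_turn[OF assms(1) _ free(1)] z2_action_involution[OF assms(3)] tree(1) by metis
  then interpret half_turn ?s r ?V .
  have "sym_tree ?s r ?V (edges T)" if "is_tree T" "verts T = ?V" "free_edges ?s ?V (edges T)" for T
    using is_tree_iff_card[of T r] that finite_V root
    by (auto simp: sym_tree_def is_tree_def inv_connects_def connects_def)
  then have pair: "tree_pair ?s r ?V (edges T\<^sub>1) (edges T\<^sub>2)"
    using tree verts free T(4) by unfold_locales auto
  have "?V \<noteq> {r}"
  proof
    assume "?V = {r}"
    then have "edges T\<^sub>1 = {}" "edges T\<^sub>2 = {}"
      using free_edgesD(1)[OF free(1)] free_edgesD(1)[OF free(2)]
        free_edges_not_subset_singleton[OF free(1), of _ r]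
        free_edges_not_subset_singleton[OF free(2), of _ r] by auto
    then show False using T(1) verts by simp
  qed
  moreover have "\<lparr>verts = ?V, edges = edges T\<^sub>1 \<union> edges T\<^sub>2\<rparr> = G" using T(5) by simp
  ultimately show ?thesis using construction_chain[OF pair] by simp
qed

end
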